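(* For any $P$-complex $K$ of rank $n$, $$f_K(t)=\sum_{\sigma\in F(K)}(-1)^{n-\mathrm{rk}\,\sigma}(t+1)^{|\sigma|}.$$
   Context: For a finite simplicial complex $K$, $f_K(t)=\sum_{\sigma\in K}t^{|\sigma|}$ (the sum includes the empty simplex), where $|\sigma|$ is the number of vertices of $\sigma$. Let $M(K)$ be the set of inclusion-maximal simplices of $K$. A simplex $\tau\in K$ is a face simplex if $\tau=\sigma_1\cap\dots\cap\sigma_s$ for some $\sigma_1,\dots,\sigma_s\in M(K)$ ($s\ge1$). $F(K)$ denotes the set of all face simplices, ordered by inclusion. $K$ is called a polytopic complex ($P$-complex) of rank $n$ if: (1) $\varnothing\in F(K)$, i.e. the intersection of all maximal simplices is empty; (2) $F(K)$ is a graded poset of rank $n$, i.e. all its inclusion-maximal chains have the same number $n+1$ of elements, so that a rank function $\mathrm{rk}$ is defined with $\mathrm{rk}(\varnothing)=0$, with $\mathrm{rk}$ increasing by $1$ along covering relations, and with $\mathrm{rk}(\sigma)=n$ for maximal simplices $\sigma$; (3) for every $\sigma\in F(K)$ there is a simplicial subcomplex $Z_\sigma$ of $\mathrm{link}_K\sigma$ such that (the geometric realization of) $Z_\sigma$ is homeomorphic to the sphere $S^{n-\mathrm{rk}(\sigma)-1}$ and $Z_\sigma$ is a strong deformation retract of $\mathrm{link}_K\sigma$; here $\mathrm{link}_K\varnothing=K$ and $S^{-1}=\varnothing$. *)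

theory Defs
  imports "HOL-Analysis.Analysis" "HOL-Computational_Algebra.Polynomial"
begin

section \<open>Finite abstract simplicial complexes\<close>

text \<open>
  The name avoids \<open>simplicial_complex\<close> of \<^theory>\<open>HOL-Analysis.Polytope\<close>, which is about
  geometric simplices in a Euclidean space. The empty simplex always belongs to a complex.
\<close>

definition finite_simplicial_complex :: "'a set set \<Rightarrow> bool" where
  "finite_simplicial_complex K \<longleftrightarrow>
     finite K \<and> (\<forall>\<sigma>\<in>K. finite \<sigma>) \<and> {} \<in> K \<and> (\<forall>\<sigma>\<in>K. \<forall>\<tau>. \<tau> \<subseteq> \<sigma> \<longrightarrow> \<tau> \<in> K)"

definition f_polynomial :: "'a set set \<Rightarrow> int poly" where
  "f_polynomial K = (\<Sum>\<sigma>\<in>K. monom 1 (card \<sigma>))"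

definition link :: "'a set set \<Rightarrow> 'a set \<Rightarrow> 'a set set" where
  "link K \<sigma> = {\<tau> \<in> K. \<tau> \<inter> \<sigma> = {} \<and> \<tau> \<union> \<sigma> \<in> K}"

text \<open>
  Points of the realization are given by barycentric coordinates; in particular the realization
  of \<open>{{}}\<close> is empty. Since the complexes are finite, the product topology induces the
  usual topology.
\<close>

definition geometric_realization :: "'a set set \<Rightarrow> ('a \<Rightarrow> real) topology" where
  "geometric_realization K =
     subtopology (powertop_real UNIV)
       {x. (\<forall>v. 0 \<le> x v) \<and> {v. x v \<noteq> 0} \<in> K \<and> (\<Sum>v\<in>{v. x v \<noteq> 0}. x v) = 1}"


section \<open>Topological notions\<close>

text \<open>The sphere of dimension \<open>d \<ge> -1\<close>, where the \<open>-1\<close>-dimensional sphere is the empty space.\<close>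

definition sphere_space :: "int \<Rightarrow> (nat \<Rightarrow> real) topology" where
  "sphere_space d = (if d < 0 then trivial_topology else nsphere (nat d))"

definition strong_deformation_retract_of_space :: "'a topology \<Rightarrow> 'a set \<Rightarrow> bool" where
  "strong_deformation_retract_of_space X S \<longleftrightarrow>
     S \<subseteq> topspace X \<and>
     (\<exists>r. r ` topspace X \<subseteq> S \<and> homotopic_with (\<lambda>g. \<forall>x\<in>S. g x = x) X X id r)"


section \<open>Face simplices and polytopic complexes\<close>

definition maximal_simplices :: "'a set set \<Rightarrow> 'a set set" where
  "maximal_simplices K = {\<sigma> \<in> K. \<forall>\<tau>\<in>K. \<not> \<sigma> \<subset> \<tau>}"

definition face_simplices :: "'a set set \<Rightarrow> 'a set set" where
  "face_simplices K = {\<tau> \<in> K. \<exists>S. S \<subseteq> maximal_simplices K \<and> finite S \<and> S \<noteq> {} \<and> \<tau> = \<Inter>S}"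

text \<open>A poset of sets, ordered by inclusion, is graded of rank \<open>n\<close>.\<close>

definition graded_of_rank :: "'a set set \<Rightarrow> nat \<Rightarrow> bool" where
  "graded_of_rank P n \<longleftrightarrow> (\<forall>C. subset.maxchain P C \<longrightarrow> finite C \<and> card C = n + 1)"

definition covers_in :: "'a set set \<Rightarrow> 'a set \<Rightarrow> 'a set \<Rightarrow> bool" where
  "covers_in P \<sigma> \<tau> \<longleftrightarrow> \<sigma> \<in> P \<and> \<tau> \<in> P \<and> \<sigma> \<subset> \<tau> \<and> \<not> (\<exists>\<rho>\<in>P. \<sigma> \<subset> \<rho> \<and> \<rho> \<subset> \<tau>)"

definition is_rank_function :: "'a set set \<Rightarrow> nat \<Rightarrow> ('a set \<Rightarrow> nat) \<Rightarrow> bool" where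
  "is_rank_function K n r \<longleftrightarrow>
     r {} = 0 \<and>
     (\<forall>\<sigma> \<tau>. covers_in (face_simplices K) \<sigma> \<tau> \<longrightarrow> r \<tau> = r \<sigma> + 1) \<and>
     (\<forall>\<sigma>\<in>maximal_simplices K. r \<sigma> = n)"

text \<open>
  If \<open>face_simplices K\<close> contains the empty simplex and is graded of rank \<open>n\<close>, a rank function
  exists and its values on \<open>face_simplices K\<close> are unique; see \<open>rk_is_rank_function\<close> and \<open>rank_function_unique\<close>.
  Values elsewhere are irrelevant.
\<close>

definition rk :: "'a set set \<Rightarrow> nat \<Rightarrow> 'a set \<Rightarrow> nat" where
  "rk K n = (SOME r. is_rank_function K n r)"

definition polytopic_complex :: "'a set set \<Rightarrow> nat \<Rightarrow> bool" where
  "polytopic_complex K n \<longleftrightarrow>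
     finite_simplicial_complex K \<and>
     {} \<in> face_simplices K \<and>
     graded_of_rank (face_simplices K) n \<and>
     (\<forall>\<sigma>\<in>face_simplices K.
        \<exists>Z. finite_simplicial_complex Z \<and> Z \<subseteq> link K \<sigma> \<and>
            geometric_realization Z homeomorphic_space sphere_space (int n - int (rk K n \<sigma>) - 1) \<and>
            strong_deformation_retract_of_space (geometric_realization (link K \<sigma>))
              (topspace (geometric_realization Z)))"


section \<open>Existence and uniqueness of the rank function\<close>

lemma finite_face_simplices: "finite K \<Longrightarrow> finite (face_simplices K)"
  by (simp add: face_simplices_def)

lemma maximal_simplices_subset_face_simplices: "maximal_simplices K \<subseteq> face_simplices K"
proof
  fix \<sigma> assume s: "\<sigma> \<in> maximal_simplices K"
  then have "\<sigma> \<in> K" by (simp add: maximal_simplices_def)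
  moreover have "{\<sigma>} \<subseteq> maximal_simplices K \<and> finite {\<sigma>} \<and> {\<sigma>} \<noteq> {} \<and> \<sigma> = \<Inter>{\<sigma>}"
    using s by simp
  ultimately show "\<sigma> \<in> face_simplices K"
    unfolding face_simplices_def by blast
qed

lemma exists_longest_chain:
  assumes "finite P"
  obtains C where "subset.chain P C" "\<forall>x\<in>C. Q x"
    "\<And>D. subset.chain P D \<Longrightarrow> \<forall>x\<in>D. Q x \<Longrightarrow> card D \<le> card C"
proof -
  let ?S = "{C. subset.chain P C \<and> (\<forall>x\<in>C. Q x)}"
  have "?S \<subseteq> Pow P" by (auto simp: subset.chain_def)
  then have fin: "finite ?S" using assms by (meson finite_Pow_iff finite_subset)
  have "{} \<in> ?S" by simp
  then have "?S \<noteq> {}" by blast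
  then have "Max (card ` ?S) \<in> card ` ?S"
    by (intro Max_in finite_imageI[OF fin]) (simp only: image_is_empty not_False_eq_True)
  then obtain C where C: "Max (card ` ?S) = card C" "C \<in> ?S" by (rule imageE)
  show thesis
  proof (rule that)
    show "subset.chain P C" "\<forall>x\<in>C. Q x" using C by auto
    show "card D \<le> card C" if "subset.chain P D" "\<forall>x\<in>D. Q x" for D
      unfolding C(1)[symmetric] using that by (intro Max_ge finite_imageI[OF fin] imageI) simp
  qed
qed

definition lower_length :: "'a set set \<Rightarrow> 'a set \<Rightarrow> nat" where
  "lower_length P \<sigma> = Max (card ` {C. subset.chain P C \<and> (\<forall>x\<in>C. x \<subset> \<sigma>)})"

lemma lower_length_eq:
  assumes "finite P" "subset.chain P C" "\<forall>x\<in>C. x \<subset> \<sigma>"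
    and "\<And>D. subset.chain P D \<Longrightarrow> \<forall>x\<in>D. x \<subset> \<sigma> \<Longrightarrow> card D \<le> card C"
  shows "lower_length P \<sigma> = card C"
  unfolding lower_length_def
proof (rule Max_eqI)
  have "{C. subset.chain P C \<and> (\<forall>x\<in>C. x \<subset> \<sigma>)} \<subseteq> Pow P" by (auto simp: subset.chain_def)
  then show "finite (card ` {C. subset.chain P C \<and> (\<forall>x\<in>C. x \<subset> \<sigma>)})"
    using assms(1) by (meson finite_Pow_iff finite_subset finite_imageI)
qed (use assms in auto)

lemma longest_chains_maxchain:
  assumes fin: "finite P" and st: "\<sigma> \<in> P" "\<tau> \<in> P" "\<sigma> \<subseteq> \<tau>"
    and between: "\<And>\<rho>. \<rho> \<in> P \<Longrightarrow> \<sigma> \<subset> \<rho> \<Longrightarrow> \<not> \<rho> \<subset> \<tau>"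
    and C: "subset.chain P C" "\<forall>x\<in>C. x \<subset> \<sigma>"
      "\<And>D. subset.chain P D \<Longrightarrow> \<forall>x\<in>D. x \<subset> \<sigma> \<Longrightarrow> card D \<le> card C"
    and E: "subset.chain P E" "\<forall>x\<in>E. \<tau> \<subset> x"
      "\<And>D. subset.chain P D \<Longrightarrow> \<forall>x\<in>D. \<tau> \<subset> x \<Longrightarrow> card D \<le> card E"
  shows "subset.maxchain P (C \<union> {\<sigma>, \<tau>} \<union> E)"
  unfolding subset.maxchain_def
proof (intro conjI notI)
  let ?M = "C \<union> {\<sigma>, \<tau>} \<union> E"
  have CP: "C \<subseteq> P" "E \<subseteq> P" using C(1) E(1) by (auto simp: subset.chain_def)
  have finC: "finite C" "finite E" using CP fin finite_subset by auto
  have totC: "\<And>x y. x \<in> C \<Longrightarrow> y \<in> C \<Longrightarrow> x \<subseteq> y \<or> y \<subseteq> x"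
    and totE: "\<And>x y. x \<in> E \<Longrightarrow> y \<in> E \<Longrightarrow> x \<subseteq> y \<or> y \<subseteq> x"
    using C(1) E(1) by (auto simp: subset_chain_def)
  have CE: "x \<subseteq> \<sigma>" "x \<subseteq> \<tau>" if "x \<in> C" for x using that C(2) st(3) by auto
  have EC: "\<sigma> \<subseteq> x" "\<tau> \<subseteq> x" if "x \<in> E" for x using that E(2) st(3) by auto
  have CEx: "x \<subseteq> y" if "x \<in> C" "y \<in> E" for x y using CE(1)[OF that(1)] EC(1)[OF that(2)] by blast
  show "subset.chain P ?M"
    unfolding subset_chain_def
  proof (intro conjI ballI)
    show "?M \<subseteq> P" using CP st by auto
    define R where "R = (\<lambda>x y :: 'a set. x \<subseteq> y \<or> y \<subseteq> x)"
    have R: "\<And>x y. x \<in> C \<Longrightarrow> y \<in> C \<Longrightarrow> R x y" "\<And>x y. x \<in> E \<Longrightarrow> y \<in> E \<Longrightarrow> R x y"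
      "\<And>x y. x \<in> C \<Longrightarrow> y \<in> E \<Longrightarrow> R x y" "\<And>x. x \<in> C \<Longrightarrow> R x \<sigma>" "\<And>x. x \<in> C \<Longrightarrow> R x \<tau>"
      "\<And>x. x \<in> E \<Longrightarrow> R x \<sigma>" "\<And>x. x \<in> E \<Longrightarrow> R x \<tau>" "R \<sigma> \<tau>"
      unfolding R_def by (simp_all add: totC totE CE EC CEx st(3))
    have sym: "R x y \<Longrightarrow> R y x" and refl: "R x x" for x y by (auto simp: R_def)
    fix x y assume "x \<in> ?M" "y \<in> ?M"
    then have "R x y"
      by (elim UnE insertE emptyE) (simp_all add: R R[THEN sym] refl)
    then show "x \<subseteq> y \<or> y \<subseteq> x" by (simp only: R_def)
  qed
  assume "\<exists>S. subset.chain P S \<and> ?M \<subset> S"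
  then obtain S where S: "subset.chain P S" "?M \<subset> S" by blast
  then obtain x where x: "x \<in> S" "x \<notin> ?M" by blast
  have xP: "x \<in> P" using S(1) x(1) by (auto simp: subset_chain_def)
  have tot: "x \<subseteq> y \<or> y \<subseteq> x" if "y \<in> ?M" for y
  proof -
    have "y \<in> S" using subsetD[OF psubset_imp_subset[OF S(2)] that] .
    then show ?thesis using S(1) x(1) by (simp add: subset_chain_def)
  qed
  have xC: "x \<notin> C" and xE: "x \<notin> E" and xs: "x \<noteq> \<sigma>" and xt: "x \<noteq> \<tau>"
    and tots: "x \<subseteq> \<sigma> \<or> \<sigma> \<subseteq> x" "x \<subseteq> \<tau> \<or> \<tau> \<subseteq> x"
    and totx: "\<forall>y\<in>C. x \<subseteq> y \<or> y \<subseteq> x" "\<forall>y\<in>E. x \<subseteq> y \<or> y \<subseteq> x"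
    using x(2) tot by simp_all
  have ins: "subset.chain P (insert x D)"
    if "subset.chain P D" "\<forall>y\<in>D. x \<subseteq> y \<or> y \<subseteq> x" for D
    using that xP unfolding subset_chain_def by (simp add: disj_commute)
  consider "x \<subset> \<sigma>" | "\<tau> \<subset> x" | "\<sigma> \<subset> x" "x \<subset> \<tau>"
    using tots xs xt by (simp add: psubset_eq) blast
  then show False
  proof cases
    case 1
    from C(3)[OF ins[OF C(1) totx(1)]] 1 C(2) finC(1) xC show False by simp
  next
    case 2
    from E(3)[OF ins[OF E(1) totx(2)]] 2 E(2) finC(2) xE show False by simp
  next
    case 3
    then show False using between[OF xP] by simp
  qed
qed

lemma lower_length_rank_function:
  assumes fin: "finite K" and bot: "{} \<in> face_simplices K"
    and gr: "graded_of_rank (face_simplices K) n"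
  shows "is_rank_function K n (lower_length (face_simplices K))"
  unfolding is_rank_function_def
proof (intro conjI allI ballI impI)
  let ?P = "face_simplices K"
  have finP: "finite ?P" using fin by (rule finite_face_simplices)
  have cardM: "card C = n + 1" if "subset.maxchain ?P C" for C
    using gr that by (simp add: graded_of_rank_def)
  have asym: "\<And>\<rho>. \<rho> \<in> ?P \<Longrightarrow> \<tau> \<subset> \<rho> \<Longrightarrow> \<not> \<rho> \<subset> \<tau>" for \<tau> by (rule less_not_sym)
  have main: "lower_length ?P \<sigma> + card ({\<sigma>, \<tau>}) + card E = n + 1"
    if st: "\<sigma> \<in> ?P" "\<tau> \<in> ?P" "\<sigma> \<subseteq> \<tau>" "\<And>\<rho>. \<rho> \<in> ?P \<Longrightarrow> \<sigma> \<subset> \<rho> \<Longrightarrow> \<not> \<rho> \<subset> \<tau>"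
      and E: "subset.chain ?P E" "\<forall>x\<in>E. \<tau> \<subset> x"
        "\<And>D. subset.chain ?P D \<Longrightarrow> \<forall>x\<in>D. \<tau> \<subset> x \<Longrightarrow> card D \<le> card E" for \<sigma> \<tau> E
  proof -
    obtain C where C: "subset.chain ?P C" "\<forall>x\<in>C. x \<subset> \<sigma>"
        "\<And>D. subset.chain ?P D \<Longrightarrow> \<forall>x\<in>D. x \<subset> \<sigma> \<Longrightarrow> card D \<le> card C"
      using exists_longest_chain[OF finP, of "\<lambda>x. x \<subset> \<sigma>" thesis] by simp
    have l: "lower_length ?P \<sigma> = card C" by (rule lower_length_eq[OF finP C])
    have finC: "finite C" "finite E"
      using C(1) E(1) finite_subset[OF _ finP] by (simp_all add: subset.chain_def)
    have disj: "C \<inter> {\<sigma>, \<tau>} = {}" "(C \<union> {\<sigma>, \<tau>}) \<inter> E = {}"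
      using C(2) E(2) st(3) by fastforce+
    have "card (C \<union> {\<sigma>, \<tau>} \<union> E) = card C + card {\<sigma>, \<tau>} + card E"
      using finC by (simp only: card_Un_disjoint[OF _ _ disj(2)] card_Un_disjoint[OF _ _ disj(1)]
          finite_Un finite.intros simp_thms)
    then show ?thesis
      using cardM[OF longest_chains_maxchain[OF finP st C E]] l by simp
  qed
  have "{C. subset.chain ?P C \<and> (\<forall>x\<in>C. x \<subset> {})} = {{}}" by auto
  then show "lower_length ?P {} = 0" by (simp add: lower_length_def)
  show "lower_length ?P \<tau> = lower_length ?P \<sigma> + 1" if cov: "covers_in ?P \<sigma> \<tau>" for \<sigma> \<tau>
  proof -
    obtain E where E: "subset.chain ?P E" "\<forall>x\<in>E. \<tau> \<subset> x"
        "\<And>D. subset.chain ?P D \<Longrightarrow> \<forall>x\<in>D. \<tau> \<subset> x \<Longrightarrow> card D \<le> card E"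
      using exists_longest_chain[OF finP, of "\<lambda>x. \<tau> \<subset> x" thesis] by simp
    have c: "\<sigma> \<in> ?P" "\<tau> \<in> ?P" "\<sigma> \<subset> \<tau>" "\<And>\<rho>. \<rho> \<in> ?P \<Longrightarrow> \<sigma> \<subset> \<rho> \<Longrightarrow> \<not> \<rho> \<subset> \<tau>"
      using cov by (auto simp: covers_in_def)
    have "lower_length ?P \<sigma> + card {\<sigma>, \<tau>} + card E = n + 1"
      using main[OF c(1) c(2) _ c(4) E] c(3) by simp
    moreover have "lower_length ?P \<tau> + card {\<tau>, \<tau>} + card E = n + 1"
      by (rule main[OF c(2) c(2) subset_refl asym E])
    moreover have "card {\<sigma>, \<tau>} = 2" using c(3) by auto
    ultimately show ?thesis by simp
  qed
  show "lower_length ?P \<sigma> = n" if s: "\<sigma> \<in> maximal_simplices K" for \<sigma>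
  proof -
    have sP: "\<sigma> \<in> ?P" using s maximal_simplices_subset_face_simplices by blast
    have no: "D = {}" if "subset.chain ?P D" "\<forall>x\<in>D. \<sigma> \<subset> x" for D
    proof (rule equals0I)
      fix x assume "x \<in> D"
      then have "x \<in> K" "\<sigma> \<subset> x" using that by (auto simp: subset_chain_def face_simplices_def)
      then show False using s by (simp add: maximal_simplices_def)
    qed
    have "lower_length ?P \<sigma> + card {\<sigma>, \<sigma>} + card ({} :: 'a set set) = n + 1"
    proof (rule main[OF sP sP subset_refl asym])
      show "card D \<le> card ({} :: 'a set set)" if "subset.chain ?P D" "\<forall>x\<in>D. \<sigma> \<subset> x" for D
        by (simp only: no[OF that] order_refl)
    qed simp_all
    then show ?thesis by simp
  qed
qed

lemma rk_is_rank_function: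
  assumes "finite K" "{} \<in> face_simplices K" "graded_of_rank (face_simplices K) n"
  shows "is_rank_function K n (rk K n)"
  unfolding rk_def by (rule someI[where P = "is_rank_function K n"], rule lower_length_rank_function[OF assms])

lemma rank_function_unique:
  assumes fin: "finite K" "\<forall>\<sigma>\<in>K. finite \<sigma>" and bot: "{} \<in> face_simplices K"
    and r: "is_rank_function K n r" and r': "is_rank_function K n r'"
    and s: "\<sigma> \<in> face_simplices K"
  shows "r \<sigma> = r' \<sigma>"
  using s
proof (induction "card \<sigma>" arbitrary: \<sigma> rule: less_induct)
  case less
  have finF: "finite \<rho>" if "\<rho> \<in> face_simplices K" for \<rho>
    using that fin(2) by (auto simp: face_simplices_def)
  show ?case
  proof (cases "\<sigma> = {}")
    case True
    then show ?thesis using r r' by (simp add: is_rank_function_def)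
  next
    case False
    let ?B = "{\<rho> \<in> face_simplices K. \<rho> \<subset> \<sigma>}"
    have "finite ?B" using finite_face_simplices[OF fin(1)] by simp
    moreover have "{} \<in> ?B" using bot False by auto
    ultimately obtain \<rho> where \<rho>: "\<rho> \<in> ?B" "\<forall>x\<in>?B. \<rho> \<subseteq> x \<longrightarrow> \<rho> = x"
      using finite_has_maximal[of ?B] by blast
    then have cov: "covers_in (face_simplices K) \<rho> \<sigma>"
      using less.prems unfolding covers_in_def by blast
    have "card \<rho> < card \<sigma>" using \<rho> finF[OF less.prems] by (auto intro: psubset_card_mono)
    then have "r \<rho> = r' \<rho>" using less.hyps \<rho> by blast
    then show ?thesis using cov r r' by (simp add: is_rank_function_def)
  qed
qed

end

theory Submission
  imports "HOL-Homology.Homology" Defs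
begin

text \<open>
  Expanding \<open>t ^ card \<tau> = ((t + 1) - 1) ^ card \<tau>\<close> over the subsets \<open>\<rho>\<close> of \<open>\<tau>\<close> shows that the
  coefficient of \<open>(t + 1) ^ card \<rho>\<close> in the \<open>f\<close>-polynomial is the alternating sum
  of \<open>(-1) ^ card \<tau>\<close> over the simplices \<open>\<tau>\<close> of the link of \<open>\<rho>\<close>. If \<open>\<rho>\<close> is not a face simplex, its
  link is a cone and the sum vanishes. If \<open>\<rho>\<close> is a face simplex, the link is homotopy equivalent to a
  sphere, and the sum is minus the reduced Euler characteristic of that sphere.

  Homotopy invariance of the Euler characteristic comes from singular homology: removing a facet
  of dimension \<open>d\<close> amounts, up to homotopy, to puncturing it at its barycenter, and by excision the
  relative homology of that pair is infinite cyclic in degree \<open>d\<close> and trivial otherwise.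
  Hence attaching the facet raises the rank in degree \<open>d\<close> or lowers it in degree \<open>d - 1\<close>, by one.
\<close>

section \<open>Rank of an abelian group\<close>

text \<open>An indexed family rather than a set of elements, so that generators are not merged when
  their images under a homomorphism coincide. Natural numbers as indices leave a fresh one whenever
  a family is enlarged.\<close>

definition lincomb :: "('a, 'm) monoid_scheme \<Rightarrow> nat set \<Rightarrow> (nat \<Rightarrow> 'a) \<Rightarrow> (nat \<Rightarrow> int) \<Rightarrow> 'a" where
  "lincomb G I g c = finprod G (\<lambda>i. g i [^]\<^bsub>G\<^esub> c i) I"

text \<open>
  The family \<open>g\<close> becomes a basis of \<open>G\<close> tensored with the rationals.
\<close>

definition rational_basis :: "('a, 'm) monoid_scheme \<Rightarrow> nat set \<Rightarrow> (nat \<Rightarrow> 'a) \<Rightarrow> bool" where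
  "rational_basis G I g \<longleftrightarrow> finite I \<and> g \<in> I \<rightarrow> carrier G \<and>
     (\<forall>c. lincomb G I g c = \<one>\<^bsub>G\<^esub> \<longrightarrow> (\<forall>i\<in>I. c i = 0)) \<and>
     (\<forall>x\<in>carrier G. \<exists>n::int. n \<noteq> 0 \<and> (\<exists>c. x [^]\<^bsub>G\<^esub> n = lincomb G I g c))"

text \<open>A relation rather than a function: that the group determines its rank is proved only for
  the groups at which ranks are read off, in \<open>has_rank_trivial\<close> and
  \<open>has_rank_integer_group\<close>.\<close>

definition has_rank :: "('a, 'm) monoid_scheme \<Rightarrow> nat \<Rightarrow> bool" where
  "has_rank G r \<longleftrightarrow> (\<exists>I g. rational_basis G I g \<and> card I = r)"

section \<open>Arithmetic of integer linear combinations\<close>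

context comm_group
begin

lemma lincomb_closed [simp]: "g \<in> I \<rightarrow> carrier G \<Longrightarrow> lincomb G I g c \<in> carrier G"
  unfolding lincomb_def by (intro finprod_closed) auto

lemma lincomb_insert:
  assumes "finite I" "i \<notin> I" "g \<in> insert i I \<rightarrow> carrier G"
  shows "lincomb G (insert i I) g c = g i [^] c i \<otimes> lincomb G I g c"
  using assms unfolding lincomb_def by (subst finprod_insert) (auto simp: Pi_iff)

lemma lincomb_remove:
  assumes "finite I" "i \<in> I" "g \<in> I \<rightarrow> carrier G"
  shows "lincomb G I g c = g i [^] c i \<otimes> lincomb G (I - {i}) g c"
  using lincomb_insert[of "I - {i}" i g c] assms by (simp add: insert_absorb)

lemma lincomb_cong:
  assumes "\<And>i. i \<in> I \<Longrightarrow> g i = g' i" "\<And>i. i \<in> I \<Longrightarrow> c i = c' i" "g' \<in> I \<rightarrow> carrier G"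
  shows "lincomb G I g c = lincomb G I g' c'"
  using assms unfolding lincomb_def by (intro finprod_cong') auto

lemma lincomb_mult:
  assumes "g \<in> I \<rightarrow> carrier G"
  shows "lincomb G I g c \<otimes> lincomb G I g d = lincomb G I g (\<lambda>i. c i + d i)"
proof -
  have "lincomb G I g (\<lambda>i. c i + d i) = finprod G (\<lambda>i. g i [^] c i \<otimes> g i [^] d i) I"
    unfolding lincomb_def using assms by (intro finprod_cong') (auto simp: int_pow_mult Pi_iff)
  also have "\<dots> = lincomb G I g c \<otimes> lincomb G I g d"
    unfolding lincomb_def using assms by (intro finprod_multf) auto
  finally show ?thesis by simp
qed

lemma lincomb_pow:
  assumes "finite I" "g \<in> I \<rightarrow> carrier G"
  shows "lincomb G I g c [^] (k::int) = lincomb G I g (\<lambda>i. k * c i)"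
  using assms
proof (induction I rule: finite_induct)
  case empty
  then show ?case by (simp add: lincomb_def)
next
  case (insert i I)
  then show ?case
    by (simp add: lincomb_insert int_pow_distrib int_pow_pow Pi_iff mult.commute)
qed

lemma lincomb_zero:
  assumes "\<And>i. i \<in> I \<Longrightarrow> c i = 0" "g \<in> I \<rightarrow> carrier G"
  shows "lincomb G I g c = \<one>"
  unfolding lincomb_def using assms by (intro finprod_one_eqI) simp

lemma lincomb_hom:
  assumes "comm_group H" "h \<in> hom G H" "finite I" "g \<in> I \<rightarrow> carrier G"
  shows "h (lincomb G I g c) = lincomb H I (h \<circ> g) c"
proof -
  interpret H: comm_group H by fact
  interpret h: group_hom G H h by unfold_locales fact
  show ?thesis
    using assms(3,4)
  proof (induction I rule: finite_induct)
    case empty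
    then show ?case by (simp add: lincomb_def)
  next
    case (insert i I)
    then show ?case
      by (subst lincomb_insert, simp, simp, simp, subst H.lincomb_insert)
        (auto simp: Pi_iff h.hom_int_pow o_def)
  qed
qed

end

section \<open>Behaviour of the rank under quotients and extensions\<close>

lemma rational_basisD:
  assumes "rational_basis G I g"
  shows "finite I" "g \<in> I \<rightarrow> carrier G"
    "\<And>c i. lincomb G I g c = \<one>\<^bsub>G\<^esub> \<Longrightarrow> i \<in> I \<Longrightarrow> c i = 0"
    "\<And>x. x \<in> carrier G \<Longrightarrow> \<exists>n::int. n \<noteq> 0 \<and> (\<exists>c. x [^]\<^bsub>G\<^esub> n = lincomb G I g c)"
  using assms unfolding rational_basis_def by blast+

text \<open>The images of a rational basis form one again. A relation among them lifts to an element
  of the kernel, some nonzero multiple \<open>n\<close> of which vanishes; independence upstairs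
  gives \<open>n * c i = 0\<close>, hence \<open>c i = 0\<close>.\<close>

lemma has_rank_torsion_quotient:
  assumes "comm_group G" "comm_group H" "h \<in> hom G H" "h ` carrier G = carrier H"
    and torsion: "\<And>x. x \<in> carrier G \<Longrightarrow> h x = \<one>\<^bsub>H\<^esub> \<Longrightarrow> \<exists>n::int. n \<noteq> 0 \<and> x [^]\<^bsub>G\<^esub> n = \<one>\<^bsub>G\<^esub>"
    and "has_rank G r"
  shows "has_rank H r"
proof -
  interpret G: comm_group G by fact
  interpret H: comm_group H by fact
  interpret h: group_hom G H h by unfold_locales fact
  obtain I g where b: "rational_basis G I g" "card I = r"
    using assms(6) unfolding has_rank_def by blast
  note b' = rational_basisD[OF b(1)]
  note lh = G.lincomb_hom[OF assms(2,3) b'(1,2)]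
  have "rational_basis H I (h \<circ> g)"
    unfolding rational_basis_def
  proof (intro conjI allI impI ballI)
    show "finite I" by fact
    show "h \<circ> g \<in> I \<rightarrow> carrier H" using b'(2) by (auto simp: Pi_iff)
  next
    fix c i assume "lincomb H I (h \<circ> g) c = \<one>\<^bsub>H\<^esub>" "i \<in> I"
    then have "h (lincomb G I g c) = \<one>\<^bsub>H\<^esub>" by (simp add: lh)
    then obtain n :: int where "n \<noteq> 0" "lincomb G I g c [^]\<^bsub>G\<^esub> n = \<one>\<^bsub>G\<^esub>"
      using torsion[OF G.lincomb_closed[OF b'(2)]] by blast
    then show "c i = 0"
      using b'(3)[of "\<lambda>i. n * c i" i] \<open>i \<in> I\<close> by (simp add: G.lincomb_pow b'(1,2))
  next
    fix y assume "y \<in> carrier H"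
    then obtain x where x: "x \<in> carrier G" "y = h x" using assms(4) by auto
    obtain n c where nc: "n \<noteq> 0" "x [^]\<^bsub>G\<^esub> (n::int) = lincomb G I g c" using b'(4)[OF x(1)] by blast
    have "y [^]\<^bsub>H\<^esub> n = lincomb H I (h \<circ> g) c"
      unfolding x(2) using x(1) by (simp add: nc(2) lh flip: h.hom_int_pow)
    with nc(1) show "\<exists>n::int. n \<noteq> 0 \<and> (\<exists>c. y [^]\<^bsub>H\<^esub> n = lincomb H I (h \<circ> g) c)"
      by blast
  qed
  then show ?thesis using b(2) unfolding has_rank_def by blast
qed

lemma has_rank_iso:
  assumes "comm_group G" "comm_group H" "h \<in> iso G H" "has_rank G r"
  shows "has_rank H r"
proof -
  interpret G: comm_group G by fact
  interpret H: comm_group H by fact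
  show ?thesis
  proof (rule has_rank_torsion_quotient[OF assms(1,2) _ _ _ assms(4)])
    show h: "h \<in> hom G H" "h ` carrier G = carrier H"
      using assms(3) by (auto simp: iso_def bij_betw_def)
    fix x assume x: "x \<in> carrier G" "h x = \<one>\<^bsub>H\<^esub>"
    have "h \<one>\<^bsub>G\<^esub> = \<one>\<^bsub>H\<^esub>" using h(1) hom_one[OF h(1)] by simp
    then have "x = \<one>\<^bsub>G\<^esub>"
      using x assms(3) by (auto simp: iso_def bij_betw_def inj_on_def)
    then show "\<exists>n::int. n \<noteq> 0 \<and> x [^]\<^bsub>G\<^esub> n = \<one>\<^bsub>G\<^esub>" by (intro exI[of _ 1]) simp
  qed
qed

lemma has_rank_isomorphic:
  assumes "comm_group G" "comm_group H" "G \<cong> H" "has_rank G r"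
  shows "has_rank H r"
  using assms has_rank_iso unfolding is_iso_def by blast

lemma has_rank_trivial:
  assumes "comm_group G" "trivial_group G"
  shows "has_rank G r \<longleftrightarrow> r = 0"
proof -
  interpret G: comm_group G by fact
  have c: "carrier G = {\<one>\<^bsub>G\<^esub>}" using assms(2) by (simp add: trivial_group_def)
  show ?thesis
  proof
    assume "has_rank G r"
    then obtain I g where b: "rational_basis G I g" "card I = r"
      unfolding has_rank_def by blast
    note b' = rational_basisD[OF b(1)]
    \<comment> \<open>Every combination is trivial here, even the one with all coefficients 1, so
      independence leaves no index.\<close>
    have "lincomb G I g (\<lambda>_. 1) = \<one>\<^bsub>G\<^esub>" using G.lincomb_closed[OF b'(2)] c by blast
    then have "I = {}" using b'(3) by fastforce
    then show "r = 0" using b by simp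
  next
    assume "r = 0"
    have "rational_basis G {} (\<lambda>_. \<one>\<^bsub>G\<^esub>)"
      unfolding rational_basis_def using c by (auto intro!: exI[of _ 1] simp: lincomb_def)
    then show "has_rank G r" using \<open>r = 0\<close> unfolding has_rank_def by (metis card.empty)
  qed
qed

lemma has_rank_integer_group:
  assumes "has_rank integer_group r"
  shows "r = 1"
proof -
  interpret comm_group integer_group by (rule abelian_integer_group)
  obtain I g where b: "rational_basis integer_group I g" "card I = r"
    using assms unfolding has_rank_def by blast
  note b' = rational_basisD[OF b(1)]
  have "I \<noteq> {}"
  proof
    assume "I = {}"
    then show False using b'(4)[of 1] by (auto simp: lincomb_def)
  qed
  then obtain i where i: "i \<in> I" by blast
  have "j = i" if j: "j \<in> I" for j
  proof (rule ccontr)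
    assume ne: "j \<noteq> i"
    \<comment> \<open>Two integers are always dependent: \<open>g j\<close> times \<open>g i\<close>
      minus \<open>g i\<close> times \<open>g j\<close> is 0. The relation is nontrivial because
      \<open>g i\<close> is nonzero, again by independence.\<close>
    define c where "c = (\<lambda>k. if k = i then g j else if k = j then - g i else 0)"
    have gi: "g i \<noteq> 0"
    proof
      assume "g i = 0"
      then have "lincomb integer_group I g (\<lambda>k. if k = i then 1 else 0) = \<one>\<^bsub>integer_group\<^esub>"
        unfolding lincomb_def by (intro finprod_one_eqI) auto
      from b'(3)[OF this i] show False by simp
    qed
    have "lincomb integer_group I g c
        = g i [^]\<^bsub>integer_group\<^esub> c i \<otimes>\<^bsub>integer_group\<^esub> (g j [^]\<^bsub>integer_group\<^esub> c j \<otimes>\<^bsub>integer_group\<^esub> lincomb integer_group (I - {i} - {j}) g c)"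
      using lincomb_remove[OF b'(1) i, of g c] lincomb_remove[of "I - {i}" j g c] b'(1) j ne
      by simp
    also have "\<dots> = \<one>\<^bsub>integer_group\<^esub>"
      using ne by (subst lincomb_zero) (auto simp: c_def)
    finally show False using b'(3)[of c j] j gi ne by (simp add: c_def)
  qed
  then have "I = {i}" using i by blast
  then show ?thesis using b by simp
qed

text \<open>The hypotheses say that \<open>j b\<close> has infinite order and spans \<open>C\<close>
  rationally. The image of a rational basis of \<open>A\<close> together with \<open>b\<close> is
  then one of \<open>B\<close>: applying \<open>j\<close> to a relation shows that the coefficient
  of \<open>b\<close> is 0, and the rest is a relation in \<open>A\<close> because \<open>i\<close>
  is injective.\<close>

lemma has_rank_extension:
  assumes "comm_group A" "comm_group B" "comm_group C"
    and i: "i \<in> hom A B" "inj_on i (carrier A)" and j: "j \<in> hom B C"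
    and exact: "\<And>x. x \<in> carrier B \<Longrightarrow> j x = \<one>\<^bsub>C\<^esub> \<longleftrightarrow> x \<in> i ` carrier A"
    and b: "b \<in> carrier B" "\<And>n::int. j b [^]\<^bsub>C\<^esub> n = \<one>\<^bsub>C\<^esub> \<Longrightarrow> n = 0"
    and C: "\<And>y. y \<in> carrier C \<Longrightarrow> \<exists>(n::int) (k::int). n \<noteq> 0 \<and> y [^]\<^bsub>C\<^esub> n = j b [^]\<^bsub>C\<^esub> k"
    and "has_rank A r"
  shows "has_rank B (Suc r)"
proof -
  interpret A: comm_group A by fact
  interpret B: comm_group B by fact
  interpret C: comm_group C by fact
  interpret i: group_hom A B i by unfold_locales fact
  interpret j: group_hom B C j by unfold_locales fact
  obtain I g where bas: "rational_basis A I g" "card I = r"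
    using assms(11) unfolding has_rank_def by blast
  note b' = rational_basisD[OF bas(1)]
  obtain m where m: "m \<notin> I" using b'(1) ex_new_if_finite by auto
  define g' where "g' = (i \<circ> g)(m := b)"
  have g': "g' \<in> insert m I \<rightarrow> carrier B" "g' \<in> I \<rightarrow> carrier B" using b'(2) b(1) m by (auto simp: g'_def Pi_iff)
  have lin: "lincomb B (insert m I) g' c = b [^]\<^bsub>B\<^esub> c m \<otimes>\<^bsub>B\<^esub> i (lincomb A I g c)" for c
  proof -
    have "lincomb B I g' c = lincomb B I (i \<circ> g) c"
      using m b'(2) by (intro B.lincomb_cong) (auto simp: g'_def Pi_iff)
    then show ?thesis
      using B.lincomb_insert[OF b'(1) m g'(1)] A.lincomb_hom[OF assms(2) i(1) b'(1,2)]
      by (simp add: g'_def)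
  qed
  have ji: "j (i x) = \<one>\<^bsub>C\<^esub>" if "x \<in> carrier A" for x using exact[of "i x"] that by auto
  have "rational_basis B (insert m I) g'"
    unfolding rational_basis_def
  proof (intro conjI allI impI ballI)
    show "finite (insert m I)" using b'(1) by simp
    show "g' \<in> insert m I \<rightarrow> carrier B" by fact
  next
    fix c k assume one: "lincomb B (insert m I) g' c = \<one>\<^bsub>B\<^esub>" and k: "k \<in> insert m I"
    have cl: "lincomb A I g c \<in> carrier A" using b'(2) by simp
    have "j (lincomb B (insert m I) g' c) = j b [^]\<^bsub>C\<^esub> c m"
      using lin cl b(1) by (simp add: ji j.hom_int_pow)
    then have cm: "c m = 0" using one b(2) by simp
    then have "i (lincomb A I g c) = \<one>\<^bsub>B\<^esub>" using one lin cl by simp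
    then have "lincomb A I g c = \<one>\<^bsub>A\<^esub>" using i(2) cl by (metis A.one_closed i.hom_one inj_onD)
    then show "c k = 0" using b'(3) cm k by blast
  next
    fix y assume y: "y \<in> carrier B"
    obtain n k :: int where nk: "n \<noteq> 0" "j y [^]\<^bsub>C\<^esub> n = j b [^]\<^bsub>C\<^esub> k" using C[OF j.hom_closed[OF y]] by blast
    \<comment> \<open>Subtracting the multiple \<open>k\<close> of \<open>b\<close> lands in the
      kernel of \<open>j\<close>, that is, in the image of \<open>A\<close>, where the basis
      \<open>g\<close> takes over.\<close>
    let ?z = "y [^]\<^bsub>B\<^esub> n \<otimes>\<^bsub>B\<^esub> b [^]\<^bsub>B\<^esub> (-k)"
    have "j ?z = j y [^]\<^bsub>C\<^esub> n \<otimes>\<^bsub>C\<^esub> j b [^]\<^bsub>C\<^esub> (-k)"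
      using y b(1) by (simp only: j.hom_mult B.int_pow_closed j.hom_int_pow)
    also have "\<dots> = \<one>\<^bsub>C\<^esub>" using nk(2) b(1) by (simp add: C.int_pow_neg)
    finally have "?z \<in> i ` carrier A" using exact[of ?z] y b(1) by simp
    then obtain x where x: "x \<in> carrier A" "?z = i x" by blast
    obtain l c where lc: "l \<noteq> 0" "x [^]\<^bsub>A\<^esub> (l::int) = lincomb A I g c" using b'(4)[OF x(1)] by blast
    have "y [^]\<^bsub>B\<^esub> n = b [^]\<^bsub>B\<^esub> k \<otimes>\<^bsub>B\<^esub> i x"
      using y b(1) x(2)[symmetric] by (simp add: B.int_pow_neg B.m_lcomm[of "b [^]\<^bsub>B\<^esub> k" "y [^]\<^bsub>B\<^esub> n"])
    then have "y [^]\<^bsub>B\<^esub> (n * l) = (b [^]\<^bsub>B\<^esub> k \<otimes>\<^bsub>B\<^esub> i x) [^]\<^bsub>B\<^esub> l"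
      using y by (simp flip: B.int_pow_pow)
    also have "\<dots> = b [^]\<^bsub>B\<^esub> (k * l) \<otimes>\<^bsub>B\<^esub> i (lincomb A I g c)"
      using b(1) x(1) by (simp add: B.int_pow_distrib B.int_pow_pow flip: lc(2) i.hom_int_pow)
    also have "\<dots> = lincomb B (insert m I) g' (c(m := k * l))"
    proof -
      have "lincomb A I g (c(m := k * l)) = lincomb A I g c"
        using m b'(2) by (intro A.lincomb_cong) auto
      then show ?thesis using lin by simp
    qed
    finally show "\<exists>n::int. n \<noteq> 0 \<and> (\<exists>c. y [^]\<^bsub>B\<^esub> n = lincomb B (insert m I) g' c)"
      using nk(1) lc(1) by (metis mult_eq_0_iff)
  qed
  then show ?thesis
    using bas(2) m b'(1) unfolding has_rank_def by (metis card_insert_disjoint)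
qed

text \<open>An exchange argument: a nonzero multiple of \<open>z\<close> is a combination of the
  basis with some nonzero coefficient \<open>c i\<close>, so \<open>z\<close> can replace
  \<open>g i\<close>. Dividing out \<open>z\<close>, which generates the kernel, leaves the other
  elements as a rational basis.\<close>

lemma has_rank_cyclic_quotient:
  assumes "comm_group A" "comm_group B"
    and h: "h \<in> hom A B" "h ` carrier A = carrier B"
    and z: "z \<in> carrier A" "\<And>n::int. z [^]\<^bsub>A\<^esub> n = \<one>\<^bsub>A\<^esub> \<Longrightarrow> n = 0"
    and ker: "\<And>x. x \<in> carrier A \<Longrightarrow> h x = \<one>\<^bsub>B\<^esub> \<longleftrightarrow> (\<exists>k::int. x = z [^]\<^bsub>A\<^esub> k)"
    and "has_rank A r"
  shows "r \<noteq> 0 \<and> has_rank B (r - 1)"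
proof -
  interpret A: comm_group A by fact
  interpret B: comm_group B by fact
  interpret h: group_hom A B h by unfold_locales fact
  obtain I g where bas: "rational_basis A I g" "card I = r"
    using assms(8) unfolding has_rank_def by blast
  note b' = rational_basisD[OF bas(1)]
  obtain m c where mc: "m \<noteq> 0" "z [^]\<^bsub>A\<^esub> (m::int) = lincomb A I g c" using b'(4)[OF z(1)] by blast
  have "\<exists>i\<in>I. c i \<noteq> 0"
  proof (rule ccontr)
    assume "\<not> ?thesis"
    then have "z [^]\<^bsub>A\<^esub> m = \<one>\<^bsub>A\<^esub>" using mc(2) A.lincomb_zero[of I c g] b'(2) by simp
    then show False using z(2) mc(1) by blast
  qed
  then obtain i where i: "i \<in> I" "c i \<noteq> 0" by blast
  let ?J = "I - {i}"
  have gJ: "g \<in> ?J \<rightarrow> carrier A" "finite ?J" using b'(1,2) by auto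
  note lh = A.lincomb_hom[OF assms(2) h(1) gJ(2,1)]
  \<comment> \<open>Combinations over \<open>?J\<close> become combinations over \<open>I\<close>
    with coefficient 0 at \<open>i\<close>, so that independence of \<open>g\<close> can compare
    them with multiples of \<open>z\<close>.\<close>
  have upd: "lincomb A ?J g d = lincomb A I g (d(i := 0))" for d
  proof -
    have "lincomb A ?J g (d(i := 0)) = lincomb A ?J g d" using gJ by (intro A.lincomb_cong) auto
    then show ?thesis using A.lincomb_remove[OF b'(1) i(1) b'(2), of "d(i := 0)"] gJ(1) by simp
  qed
  have hz: "h z = \<one>\<^bsub>B\<^esub>" using ker[OF z(1)] z(1) by (metis A.int_pow_1)
  have "rational_basis B ?J (h \<circ> g)"
    unfolding rational_basis_def
  proof (intro conjI allI impI ballI)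
    show "finite ?J" by fact
    show "h \<circ> g \<in> ?J \<rightarrow> carrier B" using gJ(1) by (auto simp: Pi_iff)
  next
    fix d k assume "lincomb B ?J (h \<circ> g) d = \<one>\<^bsub>B\<^esub>" and k: "k \<in> ?J"
    then have "h (lincomb A ?J g d) = \<one>\<^bsub>B\<^esub>" by (simp add: lh)
    then obtain l :: int where l: "lincomb A ?J g d = z [^]\<^bsub>A\<^esub> l" using ker gJ(1) by force
    \<comment> \<open>Multiplication by \<open>m\<close> allows the expansion of \<open>m\<close>
      times \<open>z\<close> to be inserted. The coefficient at \<open>i\<close> then reads
      \<open>l * c i = 0\<close>, so \<open>l\<close> vanishes and the other coefficients
      follow.\<close>
    have "lincomb A I g (\<lambda>j. m * (d(i := 0)) j) = lincomb A ?J g d [^]\<^bsub>A\<^esub> m"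
      by (simp only: upd A.lincomb_pow[OF b'(1,2)])
    also have "\<dots> = (z [^]\<^bsub>A\<^esub> m) [^]\<^bsub>A\<^esub> l" using z(1) by (simp add: l A.int_pow_pow mult.commute)
    also have "\<dots> = lincomb A I g (\<lambda>j. l * c j)" by (simp only: mc(2) A.lincomb_pow[OF b'(1,2)])
    finally have "lincomb A I g (\<lambda>j. m * (d(i := 0)) j + - 1 * (l * c j)) = lincomb A I g (\<lambda>j. l * c j) \<otimes>\<^bsub>A\<^esub> lincomb A I g (\<lambda>j. l * c j) [^]\<^bsub>A\<^esub> (- 1 :: int)"
      by (simp only: A.lincomb_mult[OF b'(2), symmetric] A.lincomb_pow[OF b'(1,2)])
    also have "\<dots> = \<one>\<^bsub>A\<^esub>" using b'(2) by (simp add: A.int_pow_neg)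
    finally have z0: "m * (d(i := 0)) j - l * c j = 0" if "j \<in> I" for j
      using b'(3)[OF _ that] by fastforce
    from z0[OF i(1)] i(2) have "l = 0" by simp
    with z0[of k] k mc(1) show "d k = 0" by simp
  next
    fix y assume "y \<in> carrier B"
    then obtain x where x: "x \<in> carrier A" "y = h x" using h(2) by auto
    obtain n a where na: "n \<noteq> 0" "x [^]\<^bsub>A\<^esub> (n::int) = lincomb A I g a" using b'(4)[OF x(1)] by blast
    \<comment> \<open>The coefficients are chosen so that the one at \<open>i\<close>, namely
      \<open>c i * a i - a i * c i\<close>, cancels; the correction by a multiple of
      \<open>z\<close> disappears under \<open>h\<close>.\<close>
    let ?w = "lincomb A I g (\<lambda>j. c i * a j + - a i * c j)"
    have "?w = lincomb A ?J g (\<lambda>j. c i * a j + - a i * c j)"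
      unfolding upd by (rule A.lincomb_cong) (use b'(2) in auto)
    moreover have "?w = (x [^]\<^bsub>A\<^esub> n) [^]\<^bsub>A\<^esub> c i \<otimes>\<^bsub>A\<^esub> (z [^]\<^bsub>A\<^esub> m) [^]\<^bsub>A\<^esub> (- a i)"
      by (simp only: na(2) mc(2) A.lincomb_mult[OF b'(2)] A.lincomb_pow[OF b'(1,2)])
    ultimately have "h (lincomb A ?J g (\<lambda>j. c i * a j + - a i * c j))
        = h ((x [^]\<^bsub>A\<^esub> n) [^]\<^bsub>A\<^esub> c i \<otimes>\<^bsub>A\<^esub> (z [^]\<^bsub>A\<^esub> m) [^]\<^bsub>A\<^esub> (- a i))" by simp
    also have "\<dots> = y [^]\<^bsub>B\<^esub> (n * c i)"
      using x z(1) by (simp add: A.int_pow_pow h.hom_int_pow hz)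
    finally have "y [^]\<^bsub>B\<^esub> (n * c i) = lincomb B ?J (h \<circ> g) (\<lambda>j. c i * a j + - a i * c j)"
      by (simp only: lh)
    then show "\<exists>n::int. n \<noteq> 0 \<and> (\<exists>c. y [^]\<^bsub>B\<^esub> n = lincomb B ?J (h \<circ> g) c)"
      using na(1) i(2) by (intro exI[where x = "n * c i"] conjI exI) simp_all
  qed
  moreover have "card ?J = r - 1" "r \<noteq> 0" using bas(2) i(1) b'(1) by (auto simp: card_gt_0_iff)
  ultimately show ?thesis unfolding has_rank_def by blast
qed


section \<open>Reduced homology of a pair with infinite cyclic relative homology\<close>

lemma comm_group_reduced_homology_group [simp]: "comm_group (reduced_homology_group p X)"
  unfolding reduced_homology_group_def
  by (rule group.abelian_subgroup_generated) auto

text \<open>In the long exact sequence of the pair, \<open>i p\<close> is an isomorphism unless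
  \<open>p\<close> is \<open>d\<close> or \<open>d - 1\<close>. What happens in these two degrees
  depends on whether \<open>j d\<close> is trivial. Tracking ranks only hides the torsion that
  arises when the image of \<open>j d\<close> is a proper nontrivial subgroup of the infinite cyclic
  group.\<close>

lemma has_rank_homology_step:
  fixes d :: int and r :: "int \<Rightarrow> nat"
  assumes ne: "topspace X \<inter> S \<noteq> {}"
    and iso: "relative_homology_group d X S \<cong> integer_group"
    and triv: "\<And>p. p \<noteq> d \<Longrightarrow> trivial_group (relative_homology_group p X S)"
    and rank: "\<And>p. has_rank (reduced_homology_group p (subtopology X S)) (r p)"
  shows "(\<forall>p. has_rank (reduced_homology_group p X) ((r(d := Suc (r d))) p)) \<or>
    (r (d - 1) \<noteq> 0 \<and> (\<forall>p. has_rank (reduced_homology_group p X) ((r(d - 1 := r (d - 1) - 1)) p)))"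
proof -
  define R where "R p = reduced_homology_group p (subtopology X S)" for p
  define T where "T p = reduced_homology_group p X" for p
  define C where "C p = relative_homology_group p X S" for p
  define i where "i p = hom_induced p (subtopology X S) {} X {} id" for p
  define j where "j p = hom_induced p X {} X S id" for p
  define b where "b p = hom_boundary p X S" for p
  note defs = R_def T_def C_def i_def j_def b_def
  have cR: "comm_group (R p)" and cT: "comm_group (T p)" and cC: "comm_group (C p)" for p
    by (simp_all add: defs)
  have e1: "exact_seq ([R (p - 1), C p, T p], [b p, j p])" for p
    unfolding defs by (rule homology_exactness_reduced_1[OF ne])
  have e2: "exact_seq ([T (p - 1), R (p - 1), C p], [i (p - 1), b p])" for p
    unfolding defs by (rule homology_exactness_reduced_2)
  have e3: "exact_seq ([C p, T p, R p], [j p, i p])" for p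
    unfolding defs by (rule homology_exactness_reduced_3)
  have ghb: "group_hom (C p) (R (p - 1)) (b p)" and ghj: "group_hom (T p) (C p) (j p)"
    and ghi: "group_hom (R p) (T p) (i p)" for p
    using e1[of p] e3[of p] by (auto simp: group_hom_def group_hom_axioms_def)
  have kb: "b p x = \<one>\<^bsub>R (p - 1)\<^esub> \<longleftrightarrow> x \<in> j p ` carrier (T p)" if "x \<in> carrier (C p)" for p x
    using e1[of p] that by (auto simp: kernel_def)
  have ki: "i p x = \<one>\<^bsub>T p\<^esub> \<longleftrightarrow> x \<in> b (p + 1) ` carrier (C (p + 1))" if "x \<in> carrier (R p)" for p x
    using e2[of "p + 1"] that by (auto simp: kernel_def)
  have kj: "j p x = \<one>\<^bsub>C p\<^esub> \<longleftrightarrow> x \<in> i p ` carrier (R p)" if "x \<in> carrier (T p)" for p x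
    using e3[of p] that by (auto simp: kernel_def)
  have hi: "i p \<in> hom (R p) (T p)" and hj: "j p \<in> hom (T p) (C p)" for p
    using ghi ghj by (simp_all add: group_hom_def group_hom_axioms_def)
  have Ctriv: "carrier (C p) = {\<one>\<^bsub>C p\<^esub>}" if "p \<noteq> d" for p
    using triv[OF that] by (simp add: defs trivial_group_def)
  have imi: "i p ` carrier (R p) = carrier (T p)" if "\<And>x. x \<in> carrier (T p) \<Longrightarrow> j p x = \<one>\<^bsub>C p\<^esub>" for p
    using kj that group_hom.hom_closed[OF ghi] by blast
  have surj: "i p ` carrier (R p) = carrier (T p)" if "p \<noteq> d" for p
    using imi Ctriv[OF that] group_hom.hom_closed[OF ghj] by blast
  have kertriv: "x = \<one>\<^bsub>R p\<^esub>" if "p \<noteq> d - 1" "x \<in> carrier (R p)" "i p x = \<one>\<^bsub>T p\<^esub>" for p x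
  proof -
    have "b (p + 1) \<one>\<^bsub>C (p + 1)\<^esub> = \<one>\<^bsub>R p\<^esub>" using group_hom.hom_one[OF ghb[of "p + 1"]] by simp
    then show ?thesis using ki[OF that(2)] that(1,3) Ctriv[of "p + 1"] by simp
  qed
  have inj: "inj_on (i p) (carrier (R p))" if "p \<noteq> d - 1" for p
    using kertriv[OF that] group_hom.inj_iff_trivial_ker[OF ghi[of p]] group_hom.hom_one[OF ghi[of p]]
      group.is_monoid[OF comm_group.axioms(2)[OF cR[of p]]]
    by (auto simp: kernel_def monoid.one_closed)
  have same: "has_rank (T p) (r p)"
    if "i p ` carrier (R p) = carrier (T p)"
      "\<And>x. x \<in> carrier (R p) \<Longrightarrow> i p x = \<one>\<^bsub>T p\<^esub> \<Longrightarrow> \<exists>n::int. n \<noteq> 0 \<and> x [^]\<^bsub>R p\<^esub> n = \<one>\<^bsub>R p\<^esub>" for p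
    using has_rank_torsion_quotient[OF cR cT hi that] rank[of p] by (simp add: R_def)
  have pow1: "x = \<one>\<^bsub>R p\<^esub> \<Longrightarrow> \<exists>n::int. n \<noteq> 0 \<and> x [^]\<^bsub>R p\<^esub> n = \<one>\<^bsub>R p\<^esub>" for p x
    using group.int_pow_one[OF comm_group.axioms(2)[OF cR]] by (intro exI[where x = 1]) auto
  have other: "has_rank (T p) (r p)" if "p \<noteq> d" "p \<noteq> d - 1" for p
    using same[OF surj[OF that(1)] pow1[OF kertriv[OF that(2)]]] by blast
  obtain f where f: "f \<in> iso integer_group (C d)"
    using group.iso_sym[OF _ iso] by (auto simp: C_def is_iso_def)
  interpret C: comm_group "C d" by (rule cC)
  interpret f: group_hom integer_group "C d" f
    using f by (auto simp: group_hom_def group_hom_axioms_def iso_def)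
  define e where "e = f 1"
  have e: "e \<in> carrier (C d)" unfolding e_def by (rule f.hom_closed) simp
  have epow: "e [^]\<^bsub>C d\<^esub> k = f k" for k :: int
    using f.hom_int_pow[of 1 k] by (simp add: e_def)
  have inj_f: "inj f" and surj_f: "range f = carrier (C d)"
    using f by (auto simp: iso_def bij_betw_def)
  have efree: "k = 0" if "e [^]\<^bsub>C d\<^esub> k = \<one>\<^bsub>C d\<^esub>" for k :: int
    using that inj_f f.hom_one by (metis epow injD one_integer_group)
  have egen: "\<exists>k::int. y = e [^]\<^bsub>C d\<^esub> k" if "y \<in> carrier (C d)" for y
    using that unfolding epow surj_f[symmetric] by blast
  interpret bh: group_hom "C d" "R (d - 1)" "b d" by (rule ghb)
  \<comment> \<open>The relative group \<open>C d\<close> is infinite cyclic, so up to torsion it either is the image of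
    \<open>T d\<close> or embeds into \<open>R (d - 1)\<close>.\<close>
  show ?thesis
  proof (cases "\<exists>x\<in>carrier (T d). j d x \<noteq> \<one>\<^bsub>C d\<^esub>")
    case True
    then obtain x where x: "x \<in> carrier (T d)" "j d x \<noteq> \<one>\<^bsub>C d\<^esub>" by blast
    have jx: "j d x \<in> carrier (C d)" using x(1) group_hom.hom_closed[OF ghj] by blast
    from egen[OF jx] obtain k where k: "j d x = e [^]\<^bsub>C d\<^esub> (k::int)" ..
    have k0: "k \<noteq> 0"
    proof
      assume "k = 0"
      with k x(2) show False by simp
    qed
    have "has_rank (T d) (Suc (r d))"
    proof (rule has_rank_extension[OF cR cT cC hi inj hj kj x(1)])
      show "n = 0" if "j d x [^]\<^bsub>C d\<^esub> n = \<one>\<^bsub>C d\<^esub>" for n :: int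
        using that k0 efree[of "k * n"] by (simp add: k C.int_pow_pow e)
      show "\<exists>(n::int) (l::int). n \<noteq> 0 \<and> y [^]\<^bsub>C d\<^esub> n = j d x [^]\<^bsub>C d\<^esub> l" if "y \<in> carrier (C d)" for y
      proof -
        from egen[OF that] obtain l where l: "y = e [^]\<^bsub>C d\<^esub> (l::int)" ..
        have "y [^]\<^bsub>C d\<^esub> k = j d x [^]\<^bsub>C d\<^esub> l" by (simp add: l k C.int_pow_pow e mult.commute)
        with k0 show ?thesis by (rule_tac x = k in exI, rule_tac x = l in exI, simp)
      qed
      show "has_rank (R d) (r d)" using rank by (simp add: R_def)
    qed auto
    \<comment> \<open>The kernel of \<open>i (d - 1)\<close> is the image of \<open>b d\<close>. It
      is torsion: the multiple \<open>k\<close> of any element of \<open>C d\<close> is a multiple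
      of \<open>j d x\<close>, which \<open>b d\<close> kills.\<close>
    moreover have "has_rank (T (d - 1)) (r (d - 1))"
    proof (rule same[OF surj])
      fix y assume y: "y \<in> carrier (R (d - 1))" "i (d - 1) y = \<one>\<^bsub>T (d - 1)\<^esub>"
      then obtain c where c: "c \<in> carrier (C d)" "y = b d c" using ki[OF y(1)] by auto
      from egen[OF c(1)] obtain l where l: "c = e [^]\<^bsub>C d\<^esub> (l::int)" ..
      have "y [^]\<^bsub>R (d - 1)\<^esub> k = b d (c [^]\<^bsub>C d\<^esub> k)" using c by (simp add: bh.hom_int_pow)
      also have "c [^]\<^bsub>C d\<^esub> k = j d x [^]\<^bsub>C d\<^esub> l"
        by (simp add: l k C.int_pow_pow e mult.commute)
      also have "b d \<dots> = b d (j d x) [^]\<^bsub>R (d - 1)\<^esub> l" using jx by (simp add: bh.hom_int_pow)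
      also have "b d (j d x) = \<one>\<^bsub>R (d - 1)\<^esub>" using kb[OF jx] x(1) by simp
      finally show "\<exists>n::int. n \<noteq> 0 \<and> y [^]\<^bsub>R (d - 1)\<^esub> n = \<one>\<^bsub>R (d - 1)\<^esub>" using k0 by auto
    qed simp
    ultimately show ?thesis using other by (auto simp: T_def)
  next
    case False
    then have sd: "i d ` carrier (R d) = carrier (T d)" using imi by blast
    have "has_rank (T d) (r d)"
    proof (rule same[OF sd])
      fix x assume "x \<in> carrier (R d)" "i d x = \<one>\<^bsub>T d\<^esub>"
      then have "x = \<one>\<^bsub>R d\<^esub>" using kertriv[of d x] by simp
      then show "\<exists>n::int. n \<noteq> 0 \<and> x [^]\<^bsub>R d\<^esub> n = \<one>\<^bsub>R d\<^esub>" by (rule pow1)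
    qed
    \<comment> \<open>Now \<open>b d\<close> is injective, since its kernel, the image of
      \<open>j d\<close>, is trivial. So \<open>b d e\<close> has infinite order and generates the
      kernel of \<open>i (d - 1)\<close>.\<close>
    moreover have "r (d - 1) \<noteq> 0 \<and> has_rank (T (d - 1)) (r (d - 1) - 1)"
    proof (rule has_rank_cyclic_quotient[OF cR cT hi surj])
      show "b d e \<in> carrier (R (d - 1))" using e by simp
      show "n = 0" if "b d e [^]\<^bsub>R (d - 1)\<^esub> n = \<one>\<^bsub>R (d - 1)\<^esub>" for n :: int
      proof -
        have "b d (e [^]\<^bsub>C d\<^esub> n) = \<one>\<^bsub>R (d - 1)\<^esub>" using that e by (simp add: bh.hom_int_pow)
        then have "e [^]\<^bsub>C d\<^esub> n \<in> j d ` carrier (T d)" using kb e by simp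
        then obtain y where "y \<in> carrier (T d)" "e [^]\<^bsub>C d\<^esub> n = j d y" by (rule imageE)
        then show ?thesis using False efree by simp
      qed
      show "i (d - 1) x = \<one>\<^bsub>T (d - 1)\<^esub> \<longleftrightarrow> (\<exists>k::int. x = b d e [^]\<^bsub>R (d - 1)\<^esub> k)"
        if x: "x \<in> carrier (R (d - 1))" for x
      proof -
        have "x \<in> b d ` carrier (C d) \<longleftrightarrow> (\<exists>k::int. x = b d (e [^]\<^bsub>C d\<^esub> k))"
        proof
          assume "x \<in> b d ` carrier (C d)"
          then obtain c where c: "c \<in> carrier (C d)" "x = b d c" by (rule imageE)
          from egen[OF c(1)] obtain k where "c = e [^]\<^bsub>C d\<^esub> (k::int)" ..
          with c(2) show "\<exists>k::int. x = b d (e [^]\<^bsub>C d\<^esub> k)" by (rule_tac x = k in exI) simp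
        next
          assume "\<exists>k::int. x = b d (e [^]\<^bsub>C d\<^esub> k)"
          then show "x \<in> b d ` carrier (C d)" using e by (elim exE) simp
        qed
        then show ?thesis using ki[OF x] e by (simp add: bh.hom_int_pow)
      qed
      show "has_rank (R (d - 1)) (r (d - 1))" using rank by (simp add: R_def)
    qed simp
    ultimately have "r (d - 1) \<noteq> 0 \<and> (\<forall>p. has_rank (T p) ((r(d - 1 := r (d - 1) - 1)) p))"
      using other by (metis fun_upd_apply)
    then show ?thesis unfolding T_def by (rule disjI2)
  qed
qed


section \<open>Puncturing a facet of the geometric realization\<close>

definition supp :: "('a \<Rightarrow> real) \<Rightarrow> 'a set" where
  "supp x = {v. x v \<noteq> 0}"

definition points :: "'a set set \<Rightarrow> ('a \<Rightarrow> real) set" where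
  "points K = {x. (\<forall>v. 0 \<le> x v) \<and> supp x \<in> K \<and> sum x (supp x) = 1}"

text \<open>The product topology is the topology of the function type, so continuity on realizations
  can be handled by \<open>continuous_on\<close>.\<close>

lemma geometric_realization_points: "geometric_realization K = top_of_set (points K)"
  by (simp add: geometric_realization_def points_def supp_def euclidean_product_topology)

lemma topspace_geometric_realization [simp]: "topspace (geometric_realization K) = points K"
  by (simp add: geometric_realization_points)

lemma pointsI:
  assumes "\<And>v. 0 \<le> x v" "supp x \<subseteq> A" "finite A" "sum x A = 1" "supp x \<in> K"
  shows "x \<in> points K"
proof -
  have "sum x (supp x) = sum x A" using assms(2,3) by (intro sum.mono_neutral_left) (auto simp: supp_def)
  then show ?thesis using assms by (simp add: points_def)
qed

lemma pointsD:
  assumes "x \<in> points K"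
  shows "0 \<le> x v" "supp x \<in> K" "sum x (supp x) = 1" "finite A \<Longrightarrow> supp x \<subseteq> A \<Longrightarrow> sum x A = 1"
proof -
  show "0 \<le> x v" "supp x \<in> K" and 1: "sum x (supp x) = 1" using assms by (auto simp: points_def)
  show "sum x A = 1" if "finite A" "supp x \<subseteq> A"
    using sum.mono_neutral_left[OF that, of x] 1 by (auto simp: supp_def)
qed

lemma continuous_on_coordinate [continuous_intros]:
  "continuous_on S (\<lambda>x :: 'a \<Rightarrow> 'b::topological_space. x v)"
  by (rule continuous_on_subset[OF continuous_on_product_coordinates]) simp

lemma continuous_on_Min_image:
  fixes f :: "'a::topological_space \<Rightarrow> 'b \<Rightarrow> 'c::linorder_topology"
  assumes "finite A" "A \<noteq> {}" "\<And>v. v \<in> A \<Longrightarrow> continuous_on S (\<lambda>x. f x v)"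
  shows "continuous_on S (\<lambda>x. Min (f x ` A))"
  using assms by (induction A rule: finite_ne_induct) (auto intro!: continuous_intros)

section \<open>Open simplices and their local homology at the barycenter\<close>

definition barycenter :: "'a set \<Rightarrow> 'a \<Rightarrow> real" where
  "barycenter \<sigma> v = (if v \<in> \<sigma> then 1 / real (card \<sigma>) else 0)"

definition open_simplex :: "'a set \<Rightarrow> ('a \<Rightarrow> real) set" where
  "open_simplex \<sigma> = {x. (\<forall>v\<in>\<sigma>. 0 < x v) \<and> (\<forall>v. v \<notin> \<sigma> \<longrightarrow> x v = 0) \<and> sum x \<sigma> = 1}"

text \<open>Here \<open>points\<close> is applied to a family that need not be a complex. Sorting
  points by their support turns a partition of the simplices into a partition of the realization, as
  in \<open>points_split\<close>.\<close>

lemma open_simplex_points: "open_simplex \<sigma> = points {\<sigma>}"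
proof (intro equalityI subsetI)
  fix x assume x: "x \<in> open_simplex \<sigma>"
  have "v \<in> supp x \<longleftrightarrow> v \<in> \<sigma>" for v
    using x by (cases "v \<in> \<sigma>") (auto simp: supp_def open_simplex_def less_le)
  then have "supp x = \<sigma>" by blast
  moreover have "0 \<le> x v" for v using x by (cases "v \<in> \<sigma>") (auto simp: open_simplex_def less_imp_le)
  ultimately show "x \<in> points {\<sigma>}" using x by (simp add: points_def open_simplex_def)
next
  fix x assume x: "x \<in> points {\<sigma>}"
  then show "x \<in> open_simplex \<sigma>"
    by (auto simp: points_def open_simplex_def supp_def less_le)
qed

lemma barycenter_in_open_simplex: "finite \<sigma> \<Longrightarrow> \<sigma> \<noteq> {} \<Longrightarrow> barycenter \<sigma> \<in> open_simplex \<sigma>"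
  by (simp add: open_simplex_def barycenter_def card_gt_0_iff)

text \<open>Logarithms of quotients of barycentric coordinates are coordinates on an open simplex.\<close>

lemma open_simplex_homeomorphic_Euclidean:
  assumes fin: "finite \<sigma>" and card: "card \<sigma> = Suc d"
  obtains f where "homeomorphic_map (Euclidean_space d) (top_of_set (open_simplex \<sigma>)) f"
    "f (\<lambda>_. 0) = barycenter \<sigma>"
proof -
  obtain e where e: "bij_betw e {..d} \<sigma>"
    using ex_bij_betw_nat_finite[OF fin] card by (auto simp: lessThan_Suc_atMost atLeast0LessThan)
  define e' where "e' = the_inv_into {..d} e"
  have ee': "v \<in> \<sigma> \<Longrightarrow> e (e' v) = v" and e'e: "i \<le> d \<Longrightarrow> e' (e i) = i"
    and e's: "v \<in> \<sigma> \<Longrightarrow> e' v \<le> d" and es: "i \<le> d \<Longrightarrow> e i \<in> \<sigma>" for v i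
    using e unfolding e'_def bij_betw_def
    by (auto simp: f_the_inv_into_f the_inv_into_f_f dest: the_inv_into_into[where B = "{..d}"])
  have sum_e: "sum g \<sigma> = (\<Sum>i\<le>d. g (e i))" for g :: "_ \<Rightarrow> real"
    using sum.reindex_bij_betw[OF e, of g] by simp
  \<comment> \<open>The map \<open>f\<close> normalises the exponentials of the coordinates. Points
    of \<open>Euclidean_space d\<close> vanish from index \<open>d\<close> on, so the vertex
    \<open>e d\<close> always has weight \<open>exp 0 = 1\<close> and serves as the reference for
    the quotients in \<open>g\<close>.\<close>
  define s where "s y = (\<Sum>i\<le>d. exp (y i))" for y :: "nat \<Rightarrow> real"
  define f where "f y v = (if v \<in> \<sigma> then exp (y (e' v)) / s y else 0)" for y :: "nat \<Rightarrow> real" and v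
  define g where "g x i = (if i < d then ln (x (e i) / x (e d)) else 0)" for x :: "_ \<Rightarrow> real" and i
  have s: "s y > 0" for y unfolding s_def by (intro sum_pos) auto
  have "homeomorphic_maps (Euclidean_space d) (top_of_set (open_simplex \<sigma>)) f g"
    unfolding homeomorphic_maps_def
  proof (intro conjI ballI)
    have "continuous_on (topspace (Euclidean_space d)) f"
    proof (rule continuous_on_coordinatewise_then_product)
      show "continuous_on (topspace (Euclidean_space d)) (\<lambda>y. f y v)" for v
        using s by (cases "v \<in> \<sigma>") (auto simp: f_def s_def less_imp_neq[symmetric] intro!: continuous_intros)
    qed
    moreover have "f y \<in> open_simplex \<sigma>" for y
    proof -
      have "sum (f y) \<sigma> = (\<Sum>i\<le>d. exp (y i) / s y)"
        unfolding sum_e f_def by (intro sum.cong) (auto simp: es e'e)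
      also have "\<dots> = 1" using s[of y] by (simp add: s_def flip: sum_divide_distrib)
      finally show ?thesis using s by (auto simp: open_simplex_def f_def)
    qed
    ultimately show "continuous_map (Euclidean_space d) (top_of_set (open_simplex \<sigma>)) f"
      by (simp add: continuous_map_in_subtopology continuous_map_Euclidean_space_iff Pi_iff image_subset_iff)
    show "continuous_map (top_of_set (open_simplex \<sigma>)) (Euclidean_space d) g"
      unfolding g_def continuous_map_componentwise_Euclidean_space
    proof (intro allI impI)
      fix i assume i: "i < d"
      have "continuous_on (open_simplex \<sigma>) (\<lambda>x. ln (x (e i) / x (e d)))"
      proof (intro continuous_intros ballI)
        fix x assume x: "x \<in> open_simplex \<sigma>"
        have "0 < x (e j)" if "j \<le> d" for j using x es[OF that] by (simp add: open_simplex_def)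
        from this[of i] this[of d] show "x (e d) \<noteq> 0" "x (e i) / x (e d) \<noteq> 0" using i by simp_all
      qed
      then show "continuous_map (top_of_set (open_simplex \<sigma>)) euclideanreal (\<lambda>x. ln (x (e i) / x (e d)))"
        by simp
    qed
    show "g (f y) = y" if y: "y \<in> topspace (Euclidean_space d)" for y
    proof
      fix i
      have "y i = 0" if "i \<ge> d" for i using y that by (simp add: topspace_Euclidean_space)
      then show "g (f y) i = y i" using s[of y] by (simp add: g_def f_def es e'e)
    qed
    show "f (g x) = x" if x: "x \<in> topspace (top_of_set (open_simplex \<sigma>))" for x
    proof
      have pos: "x v > 0" if "v \<in> \<sigma>" for v using x that by (simp add: open_simplex_def)
      have ex: "exp (g x i) = x (e i) / x (e d)" if "i \<le> d" for i
        using that pos[OF es[of i]] pos[OF es[of d]] by (cases "i = d") (auto simp: g_def)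
      have "s (g x) = (\<Sum>i\<le>d. x (e i)) / x (e d)" by (simp add: s_def ex sum_divide_distrib)
      also have "(\<Sum>i\<le>d. x (e i)) = 1" using x by (simp add: open_simplex_def flip: sum_e)
      finally have sg: "s (g x) = 1 / x (e d)" .
      show "f (g x) v = x v" for v
        using x pos[OF es[of d]] by (auto simp: f_def sg ex e's ee' open_simplex_def)
    qed
  qed
  moreover have "f (\<lambda>_. 0) = barycenter \<sigma>"
    by (rule ext) (simp add: f_def barycenter_def s_def card)
  ultimately show thesis using that homeomorphic_maps_map by blast
qed

text \<open>Removing the origin from the one-point space leaves nothing, so the relative group there
  is an absolute one. Each added dimension raises the degree by one.\<close>

lemma relative_homology_group_punctured_Euclidean_space:
  "relative_homology_group p (Euclidean_space d) (topspace (Euclidean_space d) - {\<lambda>_. 0})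
   \<cong> homology_group (p - int d) (Euclidean_space 0)"
proof -
  have top0: "topspace (Euclidean_space 0) = {\<lambda>_. 0}" by (auto simp: topspace_Euclidean_space)
  have "closedin (Euclidean_space 0) {\<lambda>_. 0}" using closedin_topspace[of "Euclidean_space 0"] top0 by simp
  from relative_homology_group_Euclidean_complement_step[OF this, of "p - int d" d]
  have "homology_group (p - int d) (Euclidean_space 0) \<cong>
      relative_homology_group p (Euclidean_space d) (topspace (Euclidean_space d) - {\<lambda>_. 0})"
    by (simp add: top0)
  then show ?thesis by (simp add: group.iso_sym)
qed

lemma relative_homology_group_punctured_open_simplex:
  assumes fin: "finite \<sigma>" and card: "card \<sigma> = Suc d"
  shows "relative_homology_group p (top_of_set (open_simplex \<sigma>)) (open_simplex \<sigma> - {barycenter \<sigma>})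
   \<cong> homology_group (p - int d) (Euclidean_space 0)"
proof -
  obtain f where f: "homeomorphic_map (Euclidean_space d) (top_of_set (open_simplex \<sigma>)) f"
    "f (\<lambda>_. 0) = barycenter \<sigma>"
    using open_simplex_homeomorphic_Euclidean[OF assms] .
  let ?E = "topspace (Euclidean_space d)"
  have bij: "bij_betw f ?E (open_simplex \<sigma>)"
    using homeomorphic_imp_injective_map[OF f(1)] homeomorphic_imp_surjective_map[OF f(1)]
    by (simp add: bij_betw_def)
  have "f ` (?E - {\<lambda>_. 0}) = f ` ?E - f ` {\<lambda>_. 0}"
    using bij by (intro inj_on_image_set_diff[of f ?E]) (auto simp: bij_betw_def topspace_Euclidean_space)
  also have "\<dots> = open_simplex \<sigma> - {barycenter \<sigma>}" using bij f(2) by (simp add: bij_betw_def)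
  finally have "relative_homology_group p (Euclidean_space d) (?E - {\<lambda>_. 0}) \<cong>
      relative_homology_group p (top_of_set (open_simplex \<sigma>)) (open_simplex \<sigma> - {barycenter \<sigma>})"
    using homeomorphic_map_relative_homology_iso[OF f(1), of "?E - {\<lambda>_. 0}"] is_isoI by blast
  then have "relative_homology_group p (top_of_set (open_simplex \<sigma>)) (open_simplex \<sigma> - {barycenter \<sigma>})
      \<cong> relative_homology_group p (Euclidean_space d) (?E - {\<lambda>_. 0})"
    by (simp add: group.iso_sym)
  from iso_trans[OF this relative_homology_group_punctured_Euclidean_space] show ?thesis .
qed

lemma homology_group_point:
  "homology_group 0 (Euclidean_space 0) \<cong> integer_group"
  "p \<noteq> 0 \<Longrightarrow> trivial_group (homology_group p (Euclidean_space 0))"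
proof -
  have "topspace (Euclidean_space 0) = {\<lambda>_. 0}" by (auto simp: topspace_Euclidean_space)
  then show "homology_group 0 (Euclidean_space 0) \<cong> integer_group"
    "p \<noteq> 0 \<Longrightarrow> trivial_group (homology_group p (Euclidean_space 0))"
    by (simp_all add: homology_coefficients homology_dimension_axiom)
qed

section \<open>A single maximal simplex: excision and radial deformation\<close>

locale facet =
  fixes K :: "'a set set" and \<sigma> :: "'a set"
  assumes complex: "finite_simplicial_complex K" and simplex: "\<sigma> \<in> K" "\<sigma> \<noteq> {}"
    and maximal: "\<And>\<tau>. \<tau> \<in> K \<Longrightarrow> \<sigma> \<subseteq> \<tau> \<Longrightarrow> \<tau> = \<sigma>"
begin

abbreviation "b \<equiv> barycenter \<sigma>"
abbreviation "n \<equiv> real (card \<sigma>)"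

lemma finite_facet: "finite \<sigma>" and card_pos: "n > 0"
proof -
  show "finite \<sigma>" using complex simplex(1) unfolding finite_simplicial_complex_def by blast
  then show "n > 0" using simplex(2) by (simp add: card_gt_0_iff)
qed

lemma points_split: "points K = points (K - {\<sigma>}) \<union> open_simplex \<sigma>" "points (K - {\<sigma>}) \<inter> open_simplex \<sigma> = {}"
  using simplex by (auto simp: open_simplex_points points_def)

lemma b_in: "b \<in> open_simplex \<sigma>" "b \<in> points K"
  using barycenter_in_open_simplex[OF finite_facet simplex(2)] points_split by auto

text \<open>By maximality, positivity at the vertices of \<sigma> already forces the support to be
  \<sigma>. These finitely many strict inequalities make the open facet open in the
  realization.\<close>

lemma open_simplex_iff: "x \<in> open_simplex \<sigma> \<longleftrightarrow> x \<in> points K \<and> (\<forall>v\<in>\<sigma>. 0 < x v)"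
proof
  show "x \<in> open_simplex \<sigma> \<Longrightarrow> x \<in> points K \<and> (\<forall>v\<in>\<sigma>. 0 < x v)"
    using points_split by (auto simp: open_simplex_def)
  assume x: "x \<in> points K \<and> (\<forall>v\<in>\<sigma>. 0 < x v)"
  then have "\<sigma> \<subseteq> supp x" by (force simp: supp_def)
  then have "supp x = \<sigma>" using maximal pointsD(2) x by blast
  then show "x \<in> open_simplex \<sigma>" using x by (simp add: open_simplex_points points_def)
qed

lemma openin_open_simplex: "openin (top_of_set (points K)) (open_simplex \<sigma>)"
proof -
  have "open {x :: 'a \<Rightarrow> real. 0 < x v}" for v by (intro open_Collect_less continuous_intros)
  then have "open (\<Inter>v\<in>\<sigma>. {x :: 'a \<Rightarrow> real. 0 < x v})" using finite_facet by (intro open_INT) auto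
  moreover have "open_simplex \<sigma> = points K \<inter> (\<Inter>v\<in>\<sigma>. {x. 0 < x v})" using open_simplex_iff by auto
  ultimately show ?thesis by (simp only: openin_open_Int)
qed

lemma openin_punctured: "openin (top_of_set (points K)) (points K - {b})"
proof -
  have "open {x :: 'a \<Rightarrow> real. x v \<noteq> b v}" for v by (intro open_Collect_neq continuous_intros)
  then have "open (\<Union>v. {x :: 'a \<Rightarrow> real. x v \<noteq> b v})" by blast
  moreover have "points K - {b} = points K \<inter> (\<Union>v. {x. x v \<noteq> b v})" by (auto simp: fun_eq_iff)
  ultimately show ?thesis by (simp only: openin_open_Int)
qed

text \<open>Excision of everything outside the open facet: that part is closed and lies in the
  punctured realization, which is open, so what remains is an open simplex relative to its
  puncture.\<close>

lemma relative_homology_group_facet: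
  assumes "card \<sigma> = Suc d"
  shows "relative_homology_group p (top_of_set (points K)) (points K - {b})
    \<cong> homology_group (p - int d) (Euclidean_space 0)"
proof -
  let ?X = "top_of_set (points K)"
  have "closedin ?X (points (K - {\<sigma>}))"
  proof -
    have "points (K - {\<sigma>}) = topspace ?X - open_simplex \<sigma>" using points_split by auto
    then show ?thesis using closedin_diff[OF closedin_topspace openin_open_simplex] by simp
  qed
  then have "?X closure_of points (K - {\<sigma>}) \<subseteq> ?X interior_of (points K - {b})"
    using openin_punctured points_split b_in by (auto simp: closure_of_closedin interior_of_openin)
  from is_isoI[OF homology_excision_axiom[OF this, of "points K" p]]
  have "relative_homology_group p (subtopology ?X (points K - points (K - {\<sigma>}))) (points K - {b} - points (K - {\<sigma>}))
     \<cong> relative_homology_group p (subtopology ?X (points K)) (points K - {b})"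
    using points_split b_in by auto
  moreover have "points K - points (K - {\<sigma>}) = open_simplex \<sigma>" "points K - {b} - points (K - {\<sigma>}) = open_simplex \<sigma> - {b}"
    using points_split by auto
  moreover have "points K \<inter> open_simplex \<sigma> = open_simplex \<sigma>" using points_split by auto
  ultimately have "relative_homology_group p (top_of_set (open_simplex \<sigma>)) (open_simplex \<sigma> - {b})
     \<cong> relative_homology_group p ?X (points K - {b})"
    by (simp add: subtopology_subtopology)
  then have "relative_homology_group p ?X (points K - {b}) \<cong>
     relative_homology_group p (top_of_set (open_simplex \<sigma>)) (open_simplex \<sigma> - {b})"
    by (simp add: group.iso_sym)
  from iso_trans[OF this relative_homology_group_punctured_open_simplex[OF finite_facet assms]]
  show ?thesis .
qed

text \<open>The radial projection from the barycenter onto the complement of the open facet subtracts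
  the smallest coordinate and renormalises.\<close>

definition least :: "('a \<Rightarrow> real) \<Rightarrow> real" where
  "least x = Min (x ` \<sigma>)"

text \<open>A straight-line homotopy from the identity at time 0 to the projection at time 1. On the
  open facet the denominator is the total mass left after the subtraction; it is positive away from
  the barycenter by \<open>least_less\<close>.\<close>

definition flow :: "real \<Rightarrow> ('a \<Rightarrow> real) \<Rightarrow> 'a \<Rightarrow> real" where
  "flow t x v = (1 - t) * x v + t * ((x v - (if v \<in> \<sigma> then least x else 0)) / (1 - n * least x))"

lemma least_le: "v \<in> \<sigma> \<Longrightarrow> least x \<le> x v" and least_in: "\<exists>v\<in>\<sigma>. least x = x v"
  and continuous_least: "continuous_on S least"
proof -
  show "v \<in> \<sigma> \<Longrightarrow> least x \<le> x v" using finite_facet by (simp add: least_def)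
  have "Min (x ` \<sigma>) \<in> x ` \<sigma>" using finite_facet simplex(2) by (intro Min_in) auto
  then show "\<exists>v\<in>\<sigma>. least x = x v" by (auto simp: least_def)
  show "continuous_on S least"
    unfolding least_def using finite_facet simplex(2) by (intro continuous_on_Min_image continuous_intros) auto
qed

text \<open>A point outside the open facet has a zero coordinate on \<sigma>, so nothing is
  subtracted and \<open>flow\<close> leaves it alone.\<close>

lemma least_0: "x \<in> points (K - {\<sigma>}) \<Longrightarrow> least x = 0"
proof -
  assume x: "x \<in> points (K - {\<sigma>})"
  then have "x \<in> points K" "x \<notin> open_simplex \<sigma>" using points_split by auto
  then obtain v where "v \<in> \<sigma>" "x v = 0"
    using open_simplex_iff[of x] pointsD(1)[of x K] by (force simp: less_le)
  moreover obtain w where "w \<in> \<sigma>" "least x = x w" using least_in by blast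
  ultimately show "least x = 0" using least_le[of v x] pointsD(1)[OF x, of w] by simp
qed

text \<open>On the open facet the coordinates have mean \<open>1 / n\<close>. Their minimum reaches
  the mean only if they all agree, that is, at the barycenter.\<close>

lemma least_less:
  assumes "x \<in> points K" "x \<noteq> b"
  shows "n * least x < 1"
proof (cases "x \<in> open_simplex \<sigma>")
  case False
  then show ?thesis using least_0 assms points_split by auto
next
  case True
  then have s: "sum x \<sigma> = 1" by (simp add: open_simplex_def)
  have le: "sum (\<lambda>_. least x) \<sigma> \<le> sum x \<sigma>" by (intro sum_mono least_le)
  have "sum (\<lambda>_. least x) \<sigma> \<noteq> sum x \<sigma>"
  proof
    assume eq: "sum (\<lambda>_. least x) \<sigma> = sum x \<sigma>"
    have "least x = x v" if "v \<in> \<sigma>" for v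
      using sum_mono_inv[OF eq least_le that finite_facet] by simp
    moreover have "least x = 1 / n" using eq s card_pos by (simp add: field_simps)
    ultimately have "x = b" using True by (auto simp: fun_eq_iff barycenter_def open_simplex_def)
    then show False using assms by blast
  qed
  with le s show ?thesis by simp
qed

lemma flow_fixes: "x \<in> points (K - {\<sigma>}) \<Longrightarrow> flow t x = x"
  using least_0[of x] by (simp add: flow_def fun_eq_iff left_diff_distrib)

lemma flow_in:
  assumes x: "x \<in> points K" "x \<noteq> b" and t: "0 \<le> t" "t \<le> 1"
  shows "flow t x \<in> points K - {b}" "t = 1 \<Longrightarrow> flow t x \<in> points (K - {\<sigma>})"
proof -
  have "flow t x \<in> points K - {b} \<and> (t = 1 \<longrightarrow> flow t x \<in> points (K - {\<sigma>}))"
  proof (cases "x \<in> open_simplex \<sigma>")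
    case False
    then have "x \<in> points (K - {\<sigma>})" using x points_split by auto
    then show ?thesis using x flow_fixes by simp
  next
    case True
    let ?m = "least x"
    define D where "D = 1 - n * ?m"
    have D: "D > 0" using least_less[OF x] by (simp add: D_def)
    have m: "?m \<ge> 0" using True least_in[of x] by (force simp: open_simplex_def)
    have f: "flow t x v = (if v \<in> \<sigma> then (1 - t) * x v + t * ((x v - ?m) / D) else 0)" for v
      using True by (auto simp: flow_def D_def open_simplex_def)
    have nonneg: "0 \<le> flow t x v" for v
      using least_le[of v x] m t D by (auto simp: f intro!: add_nonneg_nonneg mult_nonneg_nonneg divide_nonneg_pos)
    have "sum (flow t x) \<sigma> = (\<Sum>v\<in>\<sigma>. (1 - t) * x v + t * ((x v - ?m) / D))"
      by (intro sum.cong) (auto simp: f)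
    also have "\<dots> = (1 - t) * sum x \<sigma> + t * ((sum x \<sigma> - n * ?m) / D)"
      by (simp add: sum.distrib sum_subtractf flip: sum_distrib_left sum_divide_distrib)
    also have "\<dots> = 1" using True D by (simp add: open_simplex_def D_def)
    finally have sum1: "sum (flow t x) \<sigma> = 1" .
    have sub: "supp (flow t x) \<subseteq> \<sigma>" by (auto simp: supp_def f)
    then have "supp (flow t x) \<in> K" using complex simplex(1) by (auto simp: finite_simplicial_complex_def)
    then have in_K: "flow t x \<in> points K" using pointsI[OF nonneg sub finite_facet sum1] by blast
    have "flow t x \<noteq> b"
    proof
      assume eq: "flow t x = b"
      \<comment> \<open>On \<sigma> the flow is affine in the coordinate \<open>x v\<close>, with
        the same positive slope \<alpha> for every vertex. Equal coordinates of
        \<open>flow t x\<close> thus come from equal coordinates of \<open>x\<close>, which would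
        make \<open>D\<close> zero.\<close>
      define \<alpha> where "\<alpha> = 1 - t + t / D"
      have "\<alpha> > 0"
        using t D by (cases "t = 1") (auto simp: \<alpha>_def intro!: add_pos_nonneg)
      obtain w where w: "w \<in> \<sigma>" "?m = x w" using least_in by blast
      have "x v = x w" if v: "v \<in> \<sigma>" for v
      proof -
        have "flow t x v = flow t x w" using eq v w(1) by (simp add: barycenter_def)
        then have "\<alpha> * x v = \<alpha> * x w" using v w(1) by (simp add: f \<alpha>_def algebra_simps diff_divide_distrib)
        then show ?thesis using \<open>\<alpha> > 0\<close> by simp
      qed
      then have "sum x \<sigma> = n * ?m" using w(2) by simp
      then show False using D True by (simp add: D_def open_simplex_def)
    qed
    moreover have "flow t x \<in> points (K - {\<sigma>})" if "t = 1"
    proof -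
      obtain w where w: "w \<in> \<sigma>" "?m = x w" using least_in by blast
      then have "flow t x w = 0" using f[of w] that by simp
      then have "flow t x \<notin> open_simplex \<sigma>" using w(1) by (force simp: open_simplex_def)
      then show ?thesis using in_K points_split by blast
    qed
    ultimately show ?thesis using in_K by blast
  qed
  then show "flow t x \<in> points K - {b}" "t = 1 \<Longrightarrow> flow t x \<in> points (K - {\<sigma>})" by auto
qed

lemma continuous_flow: "continuous_on ({0..1} \<times> (points K - {b})) (\<lambda>(t, x). flow t x)"
proof (rule continuous_on_coordinatewise_then_product)
  fix v
  have l: "continuous_on S (\<lambda>z :: real \<times> ('a \<Rightarrow> real). least (snd z))" for S
    by (rule continuous_on_compose2[OF continuous_least continuous_on_snd[OF continuous_on_id] subset_UNIV])
  have c: "continuous_on S (\<lambda>z :: real \<times> ('a \<Rightarrow> real). snd z v)" for S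
    by (rule continuous_on_compose2[OF continuous_on_coordinate continuous_on_snd[OF continuous_on_id] subset_UNIV])
  have "1 - n * least (snd z) \<noteq> 0" if "z \<in> {0..1} \<times> (points K - {b})" for z :: "real \<times> ('a \<Rightarrow> real)"
    using least_less[of "snd z"] that by auto
  then show "continuous_on ({0..1} \<times> (points K - {b})) (\<lambda>z. (case z of (t, x) \<Rightarrow> flow t x) v)"
    unfolding flow_def case_prod_beta by (cases "v \<in> \<sigma>") (auto intro!: continuous_intros l c)
qed

text \<open>The flow stays in the punctured realization, ends in the complement of the open facet
  and fixes that complement pointwise, so it is a deformation retraction.\<close>

lemma punctured_homotopy_equivalent:
  "top_of_set (points K - {b}) homotopy_equivalent_space geometric_realization (K - {\<sigma>})"
  unfolding geometric_realization_points
proof (rule deformation_retract_imp_homotopy_equivalent_space)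
  let ?S = "points K - {b}" and ?T = "points (K - {\<sigma>})"
  have TS: "?T \<subseteq> ?S" using points_split b_in by auto
  have "homotopic_with (\<lambda>x. True) (top_of_set ?S) (top_of_set ?S) id (flow 1)"
    unfolding homotopic_with_def
  proof (intro exI conjI ballI allI)
    show "continuous_map (prod_topology (top_of_set {0..1}) (top_of_set ?S)) (top_of_set ?S) (\<lambda>(t, x). flow t x)"
      using continuous_flow flow_in(1) by auto
  qed (auto simp: flow_def)
  then show "homotopic_with (\<lambda>x. True) (top_of_set ?S) (top_of_set ?S) (flow 1) id"
    by (rule homotopic_with_symD)
  show "retraction_maps (top_of_set ?S) (top_of_set ?T) (flow 1) id"
    unfolding retraction_maps_def
  proof (intro conjI ballI)
    have "continuous_on ?S (\<lambda>x. (\<lambda>(t, x). flow t x) (1, x))"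
      by (rule continuous_on_compose2[OF continuous_flow continuous_on_Pair[OF continuous_on_const continuous_on_id]]) auto
    then have "continuous_on ?S (flow 1)" by simp
    then show "continuous_map (top_of_set ?S) (top_of_set ?T) (flow 1)"
      using flow_in(2)[of _ 1] by auto
    show "continuous_map (top_of_set ?T) (top_of_set ?S) id" using TS by auto
    show "flow 1 (id x) = x" if "x \<in> topspace (top_of_set ?T)" for x
      using that by (simp add: flow_fixes)
  qed
qed

end


section \<open>The Euler characteristic of a homotopy sphere\<close>

text \<open>Signs go by the number of vertices and the empty simplex counts 1, so this is minus the
  reduced Euler characteristic.\<close>

definition euler :: "'a set set \<Rightarrow> int" where
  "euler K = (\<Sum>\<tau>\<in>K. (-1) ^ card \<tau>)"

lemma points_mono: "Z \<subseteq> K \<Longrightarrow> points Z \<subseteq> points K"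
  by (auto simp: points_def)

lemma points_eq_empty_iff:
  assumes "finite_simplicial_complex K"
  shows "points K = {} \<longleftrightarrow> K = {{}}"
proof
  assume "points K = {}"
  have "\<tau> = {}" if "\<tau> \<in> K" for \<tau>
  proof (rule ccontr)
    assume "\<tau> \<noteq> {}"
    moreover have "finite \<tau>" using assms that by (simp add: finite_simplicial_complex_def)
    ultimately have "barycenter \<tau> \<in> points {\<tau>}"
      using barycenter_in_open_simplex open_simplex_points by blast
    then have "barycenter \<tau> \<in> points K" using that points_mono[of "{\<tau>}" K] by blast
    then show False using \<open>points K = {}\<close> by blast
  qed
  then show "K = {{}}" using assms by (auto simp: finite_simplicial_complex_def)
next
  assume K: "K = {{}}"
  show "points K = {}"
  proof (rule equals0I)
    fix x assume "x \<in> points K"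
    then have "supp x = {}" "sum x (supp x) = 1" using pointsD(2,3)[of x K] K by auto
    then show False by simp
  qed
qed

section \<open>Induction by removing facets\<close>

lemma facet_exists:
  assumes K: "finite_simplicial_complex K" "K \<noteq> {{}}"
  obtains \<sigma> where "facet K \<sigma>" "finite_simplicial_complex (K - {\<sigma>})"
proof -
  have fin: "finite K" and finK: "\<And>\<tau>. \<tau> \<in> K \<Longrightarrow> finite \<tau>" and emp: "{} \<in> K"
    and down: "\<And>\<tau> \<rho>. \<tau> \<in> K \<Longrightarrow> \<rho> \<subseteq> \<tau> \<Longrightarrow> \<rho> \<in> K"
    using K(1) unfolding finite_simplicial_complex_def by blast+
  obtain \<tau> where \<tau>: "\<tau> \<in> K" "\<tau> \<noteq> {}" using K(2) emp by blast
  obtain \<sigma> where \<sigma>: "\<sigma> \<in> K" "\<tau> \<subseteq> \<sigma>" "\<forall>\<rho>\<in>K. \<sigma> \<subseteq> \<rho> \<longrightarrow> \<sigma> = \<rho>"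
    using finite_has_maximal2[OF fin \<tau>(1)] by blast
  have "facet K \<sigma>"
    using K(1) \<sigma> \<tau>(2) by unfold_locales auto
  moreover have "finite_simplicial_complex (K - {\<sigma>})"
    unfolding finite_simplicial_complex_def
  proof (intro conjI ballI allI impI)
    show "finite (K - {\<sigma>})" using fin by simp
    show "finite \<rho>" if "\<rho> \<in> K - {\<sigma>}" for \<rho> using finK that by blast
    show "{} \<in> K - {\<sigma>}" using emp \<sigma>(2) \<tau>(2) by blast
    show "\<rho>' \<in> K - {\<sigma>}" if "\<rho> \<in> K - {\<sigma>}" "\<rho>' \<subseteq> \<rho>" for \<rho> \<rho>'
      using down[of \<rho> \<rho>'] \<sigma>(3) that by blast
  qed
  ultimately show thesis by (rule that)
qed

lemma sum_fun_upd_int: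
  fixes r :: "'a \<Rightarrow> nat" and w :: "'a \<Rightarrow> int"
  assumes "finite A" "q \<in> A"
  shows "(\<Sum>p\<in>A. w p * int ((r(q := k)) p)) = (\<Sum>p\<in>A. w p * int (r p)) + w q * (int k - int (r q))"
proof -
  have "(\<Sum>p\<in>A - {q}. w p * int ((r(q := k)) p)) = (\<Sum>p\<in>A - {q}. w p * int (r p))"
    by (intro sum.cong) auto
  then show ?thesis
    using assms by (simp add: sum.remove[of A q] algebra_simps)
qed

text \<open>
  The sum includes degree \<open>-1\<close>, where the rank is \<open>0\<close>, so that both alternatives of
  \<open>has_rank_homology_step\<close> stay within its range when the facet is a vertex.
\<close>

lemma reduced_homology_ranks:
  assumes "finite_simplicial_complex K" "K \<noteq> {{}}"
  shows "\<exists>r N. (\<forall>p. has_rank (reduced_homology_group p (geometric_realization K)) (r p)) \<and>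
    (\<forall>M\<ge>N. (\<Sum>p\<in>{-1..M}. (-1) ^ nat (p + 1) * int (r p)) = euler K)"
  using assms
proof (induction "card K" arbitrary: K rule: less_induct)
  case less
  obtain \<sigma> where "facet K \<sigma>" and K': "finite_simplicial_complex (K - {\<sigma>})"
    using facet_exists[OF less.prems] .
  interpret facet K \<sigma> by fact
  let ?K' = "K - {\<sigma>}"
  have fin: "finite K" using complex by (simp add: finite_simplicial_complex_def)
  have euler: "euler K = euler ?K' + (-1) ^ card \<sigma>"
    using fin simplex(1) by (simp add: euler_def sum.remove[of K \<sigma>])
  show ?case
  proof (cases "?K' = {{}}")
    \<comment> \<open>Removing the only vertex leaves an empty realization, whereas the reduced
      exact sequence asks for a nonempty subspace. Here \<open>K\<close> realizes to a single point
      and all reduced homology vanishes.\<close>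
    case True
    then have K: "K = {{}, \<sigma>}" using simplex(1) by blast
    obtain v where v: "v \<in> \<sigma>" using simplex(2) by blast
    then have "{v} \<in> K" using complex simplex(1) unfolding finite_simplicial_complex_def by blast
    then have s: "\<sigma> = {v}" using K by auto
    have "points K = {barycenter \<sigma>}"
    proof -
      have "points ?K' = {}" using True K' points_eq_empty_iff by metis
      moreover have "x = barycenter \<sigma>" if "x \<in> open_simplex \<sigma>" for x
        using that by (auto simp: open_simplex_def barycenter_def s fun_eq_iff)
      ultimately show ?thesis using points_split(1) b_in(1) by blast
    qed
    then have "topspace (geometric_realization K) = {barycenter \<sigma>}" by simp
    then have "trivial_group (reduced_homology_group p (geometric_realization K))" for p
      by (rule homology_dimension_reduced)
    then have "has_rank (reduced_homology_group p (geometric_realization K)) 0" for p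
      using has_rank_trivial comm_group_reduced_homology_group by blast
    moreover have "euler K = 0" unfolding euler True by (simp add: euler_def s)
    ultimately show ?thesis by (intro exI[of _ "\<lambda>_. 0"] exI[of _ 0]) simp
  next
    case False
    have "card ?K' < card K" using fin simplex(1) by (intro psubset_card_mono) auto
    from less.hyps[OF this K' False] obtain r N where
      r: "\<And>p. has_rank (reduced_homology_group p (geometric_realization ?K')) (r p)"
      and N: "\<And>M. N \<le> M \<Longrightarrow> (\<Sum>p\<in>{-1..M}. (-1) ^ nat (p + 1) * int (r p)) = euler ?K'"
      by blast
    obtain d where d: "card \<sigma> = Suc d" using card_pos by (cases "card \<sigma>") auto
    let ?X = "geometric_realization K" and ?S = "points K - {b}"
    have X: "?X = top_of_set (points K)" by (rule geometric_realization_points)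
    have sub: "subtopology ?X ?S = top_of_set ?S"
      unfolding X subtopology_subtopology by (rule arg_cong[where f = top_of_set]) blast
    have rel: "relative_homology_group p ?X ?S \<cong> homology_group (p - int d) (Euclidean_space 0)" for p
      unfolding X by (rule relative_homology_group_facet[OF d])
    define good where "good r \<longleftrightarrow> (\<forall>p. has_rank (reduced_homology_group p ?X) (r p))" for r :: "int \<Rightarrow> nat"
    have "good (r(int d := Suc (r (int d)))) \<or>
      (r (int d - 1) \<noteq> 0 \<and> good (r(int d - 1 := r (int d - 1) - 1)))"
      unfolding good_def
    proof (rule has_rank_homology_step[where S = ?S])
      have "points ?K' \<noteq> {}" using points_eq_empty_iff[OF K'] False by simp
      then show "topspace ?X \<inter> ?S \<noteq> {}" using points_split b_in by auto
      show "relative_homology_group (int d) ?X ?S \<cong> integer_group"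
        using iso_trans[OF rel[of "int d"]] homology_group_point(1) by simp
      show "trivial_group (relative_homology_group p ?X ?S)" if "p \<noteq> int d" for p
        using isomorphic_group_triviality[OF rel[of p]] homology_group_point(2)[of "p - int d"] that by simp
      show "has_rank (reduced_homology_group p (subtopology ?X ?S)) (r p)" for p
      proof -
        have "geometric_realization ?K' homotopy_equivalent_space top_of_set ?S"
          using punctured_homotopy_equivalent by (rule homotopy_equivalent_space_sym[THEN iffD1])
        then have "reduced_homology_group p (geometric_realization ?K') \<cong> reduced_homology_group p (top_of_set ?S)"
          by (rule homotopy_equivalent_space_imp_isomorphic_reduced_homology_groups)
        from has_rank_isomorphic[OF _ _ this r] show ?thesis
          unfolding sub by simp
      qed
    qed
    \<comment> \<open>Raising the rank in degree \<open>d\<close> adds the weight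
      \<open>(-1) ^ (d + 1)\<close>; lowering it in degree \<open>d - 1\<close> subtracts
      \<open>(-1) ^ d\<close>. Both equal the contribution of \<sigma> to \<open>euler K\<close>. A
      bound \<open>M\<close> of at least \<open>q\<close> keeps the changed degree within the
      sum.\<close>
    moreover have "\<exists>r N. good r \<and> (\<forall>M\<ge>N. (\<Sum>p\<in>{-1..M}. (-1) ^ nat (p + 1) * int (r p)) = euler K)"
      if "good (r(q := k))" "-1 \<le> q" "(-1) ^ nat (q + 1) * (int k - int (r q)) = (-1) ^ card \<sigma>" for q k
    proof (intro exI conjI allI impI)
      show "good (r(q := k))" by fact
      fix M assume M: "max N q \<le> M"
      then have "q \<in> {-1..M}" using that(2) by simp
      from sum_fun_upd_int[OF finite_atLeastAtMost_int this, of "\<lambda>p. (-1) ^ nat (p + 1)" r k]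
      show "(\<Sum>p\<in>{-1..M}. (-1) ^ nat (p + 1) * int ((r(q := k)) p)) = euler K"
        using N[of M] M that(3) euler by simp
    qed
    moreover have "nat (int d + 1) = card \<sigma>" "nat (int d - 1 + 1) = d" using d by simp_all
    ultimately have "\<exists>r N. good r \<and> (\<forall>M\<ge>N. (\<Sum>p\<in>{-1..M}. (-1) ^ nat (p + 1) * int (r p)) = euler K)"
      using d by (elim disjE) (auto simp: of_nat_diff)
    then show ?thesis by (simp add: good_def)
  qed
qed

text \<open>The ranks obtained for \<open>K\<close> are also ranks of the reduced homology of the
  sphere, which pins them down: 1 in degree \<open>k\<close> and 0 elsewhere. A single term of the
  alternating sum survives.\<close>

lemma euler_homotopy_sphere:
  assumes K: "finite_simplicial_complex K"
    and eq: "geometric_realization K homotopy_equivalent_space nsphere k"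
  shows "euler K = (-1) ^ Suc k"
proof -
  \<comment> \<open>The complex excluded by \<open>reduced_homology_ranks\<close> has empty
    realization, and a nonempty sphere has no map into it.\<close>
  have "K \<noteq> {{}}"
  proof
    assume "K = {{}}"
    then have "points K = {}" using points_eq_empty_iff[OF K] by simp
    moreover obtain g where "continuous_map (nsphere k) (geometric_realization K) g"
      using eq unfolding homotopy_equivalent_space_def by blast
    ultimately show False
      using in_topspace_nsphere[of k] by (auto simp: continuous_map_def Pi_iff)
  qed
  from reduced_homology_ranks[OF K this] obtain r N where
    r: "\<And>p. has_rank (reduced_homology_group p (geometric_realization K)) (r p)"
    and N: "\<And>M. N \<le> M \<Longrightarrow> (\<Sum>p\<in>{-1..M}. (-1) ^ nat (p + 1) * int (r p)) = euler K"
    by blast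
  have iso: "reduced_homology_group p (geometric_realization K) \<cong> reduced_homology_group p (nsphere k)" for p
    by (rule homotopy_equivalent_space_imp_isomorphic_reduced_homology_groups[OF eq])
  have r': "has_rank (reduced_homology_group p (nsphere k)) (r p)" for p
    by (rule has_rank_isomorphic[OF _ _ iso r]) simp_all
  have r0: "r p = 0" if "p \<noteq> int k" for p
    using r'[of p] has_rank_trivial[OF comm_group_reduced_homology_group reduced_homology_group_nsphere(2)[OF that]]
    by simp
  have rk: "r (int k) = 1"
    by (rule has_rank_integer_group, rule has_rank_isomorphic[OF _ _ reduced_homology_group_nsphere(1) r'])
      (simp_all add: abelian_integer_group)
  define M where "M = max N (int k)"
  have "euler K = (\<Sum>p\<in>{-1..M}. (-1) ^ nat (p + 1) * int (r p))" using N[of M] by (simp add: M_def)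
  also have "\<dots> = (\<Sum>p\<in>{int k}. (-1) ^ nat (p + 1) * int (r p))"
    by (rule sum.mono_neutral_right) (auto simp: M_def r0)
  also have "\<dots> = (-1) ^ Suc k" by (simp add: rk nat_add_distrib)
  finally show ?thesis .
qed

section \<open>Links that retract onto spheres\<close>

lemma strong_deformation_retract_homotopy_equivalent:
  assumes "strong_deformation_retract_of_space X S"
  shows "X homotopy_equivalent_space subtopology X S"
proof -
  obtain r where S: "S \<subseteq> topspace X" and r: "r ` topspace X \<subseteq> S"
    and h: "homotopic_with (\<lambda>g. \<forall>x\<in>S. g x = x) X X id r"
    using assms unfolding strong_deformation_retract_of_space_def by blast
  have fix_S: "\<forall>x\<in>S. r x = x" using homotopic_with_imp_property[OF h] by blast
  have cont: "continuous_map X X r" using homotopic_with_imp_continuous_maps[OF h] by blast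
  show ?thesis
  proof (rule deformation_retract_imp_homotopy_equivalent_space)
    have "homotopic_with (\<lambda>x. True) X X id r" using h by (rule homotopic_with_mono) simp
    then show "homotopic_with (\<lambda>x. True) X X r id" by (rule homotopic_with_symD)
    show "retraction_maps X (subtopology X S) r id"
      unfolding retraction_maps_def
      using cont r S fix_S by (auto simp: continuous_map_in_subtopology continuous_map_from_subtopology)
  qed
qed

lemma finite_simplicial_complex_link:
  assumes K: "finite_simplicial_complex K" and "\<sigma> \<in> K"
  shows "finite_simplicial_complex (link K \<sigma>)"
proof -
  have fin: "finite K" and finK: "\<And>\<tau>. \<tau> \<in> K \<Longrightarrow> finite \<tau>" and emp: "{} \<in> K"
    and down: "\<And>\<tau> \<rho>. \<tau> \<in> K \<Longrightarrow> \<rho> \<subseteq> \<tau> \<Longrightarrow> \<rho> \<in> K"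
    using K(1) unfolding finite_simplicial_complex_def by blast+
  show ?thesis
    unfolding finite_simplicial_complex_def
  proof (intro conjI ballI allI impI)
    show "finite (link K \<sigma>)" using fin by (simp add: link_def)
    show "finite \<tau>" if "\<tau> \<in> link K \<sigma>" for \<tau> using finK that by (simp add: link_def)
    show "{} \<in> link K \<sigma>" using emp assms(2) by (simp add: link_def)
    show "\<rho> \<in> link K \<sigma>" if "\<tau> \<in> link K \<sigma>" "\<rho> \<subseteq> \<tau>" for \<tau> \<rho>
    proof -
      have "\<tau> \<in> K" "\<tau> \<inter> \<sigma> = {}" "\<tau> \<union> \<sigma> \<in> K" using that(1) by (simp_all add: link_def)
      moreover have "\<rho> \<in> K" using down[of \<tau> \<rho>] that(2) \<open>\<tau> \<in> K\<close> by blast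
      moreover have "\<rho> \<union> \<sigma> \<in> K" using down[of "\<tau> \<union> \<sigma>" "\<rho> \<union> \<sigma>"] that(2) \<open>\<tau> \<union> \<sigma> \<in> K\<close> by blast
      ultimately show ?thesis using that(2) by (auto simp: link_def)
    qed
  qed
qed

text \<open>The sphere has dimension \<open>n - m - 1\<close>, and counting vertices instead of
  dimensions shifts the exponent by one, whence \<open>n - m\<close>. The empty sphere obeys the
  same formula.\<close>

lemma euler_sphere_retract:
  assumes K: "finite_simplicial_complex K" and Z: "Z \<subseteq> K"
    and hom: "geometric_realization Z homeomorphic_space sphere_space (int n - int m - 1)"
    and retr: "strong_deformation_retract_of_space (geometric_realization K) (topspace (geometric_realization Z))"
  shows "euler K = (-1) ^ (n - m)"
proof (cases "int n - int m - 1 < 0")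
  \<comment> \<open>The retract is empty, hence so is the realization of \<open>K\<close>, which
    \<open>r\<close> maps into it. Only the empty simplex remains, contributing 1, and the natural
    number \<open>n - m\<close> is 0.\<close>
  case True
  then have "geometric_realization Z homeomorphic_space (trivial_topology :: (nat \<Rightarrow> real) topology)"
    using hom by (simp add: sphere_space_def)
  then have "points Z = {}"
    using homeomorphic_empty_space_eq by (metis topspace_geometric_realization null_topspace_iff_trivial homeomorphic_empty_space)
  moreover obtain r where "r ` points K \<subseteq> points Z"
    using retr unfolding strong_deformation_retract_of_space_def by auto
  ultimately have "points K = {}" by blast
  then have "K = {{}}" using points_eq_empty_iff[OF K] by simp
  then show ?thesis using True by (simp add: euler_def)
next
  case False
  define k where "k = n - m - 1"
  have k: "nat (int n - int m - 1) = k" "n - m = Suc k" using False by (auto simp: k_def)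
  have "geometric_realization K homotopy_equivalent_space subtopology (geometric_realization K) (points Z)"
    using strong_deformation_retract_homotopy_equivalent[OF retr] by simp
  moreover have "subtopology (geometric_realization K) (points Z) = geometric_realization Z"
    unfolding geometric_realization_points subtopology_subtopology
    using points_mono[OF Z] by (simp add: Int_absorb1)
  moreover have "geometric_realization Z homotopy_equivalent_space nsphere k"
    using hom False k(1) by (simp add: sphere_space_def homeomorphic_imp_homotopy_equivalent_space)
  ultimately have "geometric_realization K homotopy_equivalent_space nsphere k"
    by (metis homotopy_eqv_trans)
  then show ?thesis using euler_homotopy_sphere[OF K] k(2) by metis
qed


section \<open>The expansion of the f-polynomial in powers of t + 1\<close>

text \<open>Toggling the apex \<open>v\<close> pairs simplices whose vertex numbers differ by one,
  so the signs cancel.\<close>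

lemma euler_cone:
  assumes "finite L" "\<And>\<tau>. \<tau> \<in> L \<Longrightarrow> finite \<tau>"
    and "\<And>\<tau>. \<tau> \<in> L \<Longrightarrow> insert v \<tau> \<in> L" "\<And>\<tau>. \<tau> \<in> L \<Longrightarrow> \<tau> - {v} \<in> L"
  shows "euler L = 0"
proof -
  define A where "A = {\<tau> \<in> L. v \<notin> \<tau>}"
  have L: "L = A \<union> insert v ` A"
  proof (intro equalityI subsetI)
    fix \<tau> assume t: "\<tau> \<in> L"
    show "\<tau> \<in> A \<union> insert v ` A"
    proof (cases "v \<in> \<tau>")
      case True
      then have "\<tau> = insert v (\<tau> - {v})" by blast
      moreover have "\<tau> - {v} \<in> A" using assms(4)[OF t] by (simp add: A_def)
      ultimately show ?thesis by blast
    qed (use t in \<open>simp add: A_def\<close>)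
  qed (use assms(3) in \<open>auto simp: A_def\<close>)
  have finA: "finite A" using assms(1) by (simp add: A_def)
  have inj: "inj_on (insert v) A" by (auto simp: inj_on_def A_def)
  have "euler L = (\<Sum>\<tau>\<in>A. (-1) ^ card \<tau>) + (\<Sum>\<tau>\<in>insert v ` A. (-1) ^ card \<tau>)"
    unfolding euler_def L using finA by (intro sum.union_disjoint) (auto simp: A_def)
  also have "(\<Sum>\<tau>\<in>insert v ` A. (-1) ^ card \<tau>) = (\<Sum>\<tau>\<in>A. (-1 :: int) ^ card (insert v \<tau>))"
    using inj by (simp add: sum.reindex)
  also have "\<dots> = (\<Sum>\<tau>\<in>A. - ((-1) ^ card \<tau>))"
    using assms(2) by (intro sum.cong) (auto simp: A_def)
  finally show ?thesis by (simp add: sum_negf)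
qed

text \<open>The intersection of all maximal simplices above \<rho> is a face simplex, so it has a
  vertex \<open>v\<close> outside \<rho>. Every simplex containing \<rho> extends to a maximal one,
  which contains \<open>v\<close>; hence \<open>v\<close> is an apex of the link.\<close>

lemma euler_link_not_face:
  assumes K: "finite_simplicial_complex K" and \<rho>: "\<rho> \<in> K" "\<rho> \<notin> face_simplices K"
  shows "euler (link K \<rho>) = 0"
proof -
  have fin: "finite K" and down: "\<And>\<tau> \<rho>. \<tau> \<in> K \<Longrightarrow> \<rho> \<subseteq> \<tau> \<Longrightarrow> \<rho> \<in> K"
    using K(1) unfolding finite_simplicial_complex_def by blast+
  have above: "\<exists>\<mu>\<in>maximal_simplices K. \<tau> \<subseteq> \<mu>" if \<tau>: "\<tau> \<in> K" for \<tau>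
  proof -
    obtain \<mu> where "\<mu> \<in> K" "\<tau> \<subseteq> \<mu>" "\<forall>\<nu>\<in>K. \<mu> \<subseteq> \<nu> \<longrightarrow> \<mu> = \<nu>"
      using finite_has_maximal2[OF fin \<tau>] by blast
    then show ?thesis unfolding maximal_simplices_def by blast
  qed
  define S where "S = {\<mu> \<in> maximal_simplices K. \<rho> \<subseteq> \<mu>}"
  have S: "S \<subseteq> maximal_simplices K" "finite S" "S \<noteq> {}"
    using above[OF \<rho>(1)] fin by (auto simp: S_def maximal_simplices_def)
  obtain \<mu> where \<mu>: "\<mu> \<in> S" using S(3) by blast
  have "\<mu> \<in> K" using S(1) \<mu> by (auto simp: maximal_simplices_def)
  moreover have "\<Inter>S \<subseteq> \<mu>" using \<mu> by blast
  ultimately have "\<Inter>S \<in> K" using down by blast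
  then have "\<Inter>S \<in> face_simplices K" using S unfolding face_simplices_def by blast
  then have "\<Inter>S \<noteq> \<rho>" using \<rho>(2) by blast
  moreover have "\<rho> \<subseteq> \<Inter>S" by (auto simp: S_def)
  ultimately obtain v where v: "v \<in> \<Inter>S" "v \<notin> \<rho>" by blast
  have L: "finite_simplicial_complex (link K \<rho>)" by (rule finite_simplicial_complex_link[OF K \<rho>(1)])
  show ?thesis
  proof (rule euler_cone[where v = v])
    show "finite \<tau>" if "\<tau> \<in> link K \<rho>" for \<tau>
      using L that unfolding finite_simplicial_complex_def by blast
    show "finite (link K \<rho>)" using L unfolding finite_simplicial_complex_def by blast
    show "\<tau> - {v} \<in> link K \<rho>" if "\<tau> \<in> link K \<rho>" for \<tau>
      using L that unfolding finite_simplicial_complex_def by blast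
    show "insert v \<tau> \<in> link K \<rho>" if \<tau>: "\<tau> \<in> link K \<rho>" for \<tau>
    proof -
      have "\<tau> \<union> \<rho> \<in> K" "\<tau> \<inter> \<rho> = {}" using \<tau> by (simp_all add: link_def)
      then obtain \<mu> where \<mu>: "\<mu> \<in> maximal_simplices K" "\<tau> \<union> \<rho> \<subseteq> \<mu>" using above by blast
      then have "v \<in> \<mu>" using v(1) by (simp add: S_def)
      moreover have "\<mu> \<in> K" using \<mu>(1) by (simp add: maximal_simplices_def)
      ultimately have "insert v (\<tau> \<union> \<rho>) \<in> K" "insert v \<tau> \<in> K"
        using down[of \<mu>] \<mu>(2) by auto
      then show ?thesis using v(2) \<open>\<tau> \<inter> \<rho> = {}\<close> by (simp add: link_def)
    qed
  qed
qed

text \<open>Each vertex of \<tau> contributes a factor \<open>(t + 1) + (-1)\<close>; in the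
  expanded product, \<rho> records the vertices at which \<open>t + 1\<close> is chosen.\<close>

lemma monom_expansion:
  assumes "finite \<tau>"
  shows "monom (1 :: int) (card \<tau>) = (\<Sum>\<rho>\<in>Pow \<tau>. (monom 1 1 + 1) ^ card \<rho> * (-1) ^ card (\<tau> - \<rho>))"
proof -
  have "monom (1 :: int) (card \<tau>) = (\<Prod>v\<in>\<tau>. (monom 1 1 + 1) + (-1))"
    by (simp add: monom_power)
  also have "\<dots> = (\<Sum>\<rho>\<in>Pow \<tau>. (\<Prod>v\<in>\<rho>. monom 1 1 + 1) * (\<Prod>v\<in>\<tau> - \<rho>. -1))"
    by (rule prod_add) (rule assms)
  finally show ?thesis by simp
qed

text \<open>After exchanging the two summations, the simplices \<tau> above a fixed \<rho>
  correspond to those of its link by removing \<rho>, and the sign depends only on the number of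
  vertices left.\<close>

lemma f_polynomial_euler_links:
  assumes K: "finite_simplicial_complex K"
  shows "f_polynomial K = (\<Sum>\<rho>\<in>K. of_int (euler (link K \<rho>)) * (monom 1 1 + 1) ^ card \<rho>)"
proof -
  have fin: "finite K" and finK: "\<And>\<tau>. \<tau> \<in> K \<Longrightarrow> finite \<tau>"
    and down: "\<And>\<tau> \<rho>. \<tau> \<in> K \<Longrightarrow> \<rho> \<subseteq> \<tau> \<Longrightarrow> \<rho> \<in> K"
    using K unfolding finite_simplicial_complex_def by blast+
  let ?X = "monom 1 1 + 1 :: int poly"
  have "f_polynomial K = (\<Sum>\<tau>\<in>K. \<Sum>\<rho>\<in>Pow \<tau>. ?X ^ card \<rho> * (-1) ^ card (\<tau> - \<rho>))"
    unfolding f_polynomial_def using finK by (intro sum.cong refl monom_expansion)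
  also have "\<dots> = (\<Sum>\<tau>\<in>K. \<Sum>\<rho> | \<rho> \<in> K \<and> \<rho> \<subseteq> \<tau>. ?X ^ card \<rho> * (-1) ^ card (\<tau> - \<rho>))"
    using down by (intro sum.cong refl) blast
  also have "\<dots> = (\<Sum>\<rho>\<in>K. \<Sum>\<tau> | \<tau> \<in> K \<and> \<rho> \<subseteq> \<tau>. ?X ^ card \<rho> * (-1) ^ card (\<tau> - \<rho>))"
    by (rule sum.swap_restrict[OF fin fin])
  also have "\<dots> = (\<Sum>\<rho>\<in>K. of_int (euler (link K \<rho>)) * ?X ^ card \<rho>)"
  proof (rule sum.cong[OF refl])
    fix \<rho> assume "\<rho> \<in> K"
    have "(\<Sum>\<tau> | \<tau> \<in> K \<and> \<rho> \<subseteq> \<tau>. (-1) ^ card (\<tau> - \<rho>)) = (\<Sum>\<tau>\<in>link K \<rho>. (-1 :: int poly) ^ card \<tau>)"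
    proof (rule sum.reindex_bij_witness[where i = "\<lambda>\<tau>. \<tau> \<union> \<rho>" and j = "\<lambda>\<tau>. \<tau> - \<rho>"])
      show "\<tau> - \<rho> \<in> link K \<rho>" if "\<tau> \<in> {\<tau>. \<tau> \<in> K \<and> \<rho> \<subseteq> \<tau>}" for \<tau>
        using that down[of \<tau> "\<tau> - \<rho>"] by (auto simp: link_def Un_absorb2)
    qed (auto simp: link_def)
    also have "\<dots> = of_int (euler (link K \<rho>))" by (simp add: euler_def)
    finally have S: "(\<Sum>\<tau> | \<tau> \<in> K \<and> \<rho> \<subseteq> \<tau>. (-1) ^ card (\<tau> - \<rho>)) = (of_int (euler (link K \<rho>)) :: int poly)" .
    show "(\<Sum>\<tau> | \<tau> \<in> K \<and> \<rho> \<subseteq> \<tau>. ?X ^ card \<rho> * (-1) ^ card (\<tau> - \<rho>)) = of_int (euler (link K \<rho>)) * ?X ^ card \<rho>"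
      unfolding sum_distrib_left[symmetric] S by (rule mult.commute)
  qed
  finally show ?thesis .
qed

theorem theorem9:
  fixes K :: "'a set set" and n :: nat
  assumes "polytopic_complex K n"
  shows "f_polynomial K =
    (\<Sum>\<sigma>\<in>face_simplices K. (-1) ^ (n - rk K n \<sigma>) * (monom 1 1 + 1) ^ card \<sigma>)"
proof -
  have K: "finite_simplicial_complex K" and fin: "finite K"
    using assms by (simp_all add: polytopic_complex_def finite_simplicial_complex_def)
  have sub: "face_simplices K \<subseteq> K" by (auto simp: face_simplices_def)
  have face: "euler (link K \<sigma>) = (-1) ^ (n - rk K n \<sigma>)" if \<sigma>: "\<sigma> \<in> face_simplices K" for \<sigma>
  proof -
    obtain Z where "Z \<subseteq> link K \<sigma>"
      "geometric_realization Z homeomorphic_space sphere_space (int n - int (rk K n \<sigma>) - 1)"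
      "strong_deformation_retract_of_space (geometric_realization (link K \<sigma>)) (topspace (geometric_realization Z))"
      using assms \<sigma> unfolding polytopic_complex_def by blast
    then show ?thesis
      using sub \<sigma> by (intro euler_sphere_retract finite_simplicial_complex_link K) auto
  qed
  have "f_polynomial K = (\<Sum>\<sigma>\<in>K. of_int (euler (link K \<sigma>)) * (monom 1 1 + 1) ^ card \<sigma>)"
    by (rule f_polynomial_euler_links[OF K])
  also have "\<dots> = (\<Sum>\<sigma>\<in>face_simplices K. of_int (euler (link K \<sigma>)) * (monom 1 1 + 1) ^ card \<sigma>)"
    using euler_link_not_face[OF K] by (intro sum.mono_neutral_right fin sub) auto
  also have "\<dots> = (\<Sum>\<sigma>\<in>face_simplices K. (-1) ^ (n - rk K n \<sigma>) * (monom 1 1 + 1) ^ card \<sigma>)"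
    by (intro sum.cong) (simp_all add: face)
  finally show ?thesis .
qed

end
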